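(* Let $f\in\mathcal{S}$, and let $\Gamma_2$ and $\Gamma_3$ be the second and third logarithmic coefficients of its inverse function $f^{-1}$. Then $$|\Gamma_3|-|\Gamma_2|\le \frac{11}{6}.$$ The bound is sharp.
   Context: Let $\mathbb{D}=\{z\in\mathbb{C}:|z|<1\}$. $\mathcal{A}$ is the class of functions $f$ analytic in $\mathbb{D}$ of the form $f(z)=z+a_2z^2+a_3z^3+\cdots$, and $\mathcal{S}$ is the subclass of $\mathcal{A}$ of functions univalent (injective) in $\mathbb{D}$. By Koebe's $1/4$ theorem, each $f\in\mathcal{S}$ has an inverse $f^{-1}$ defined at least on the disk $|w|<1/4$, with expansion $f^{-1}(w)=w+A_2w^2+A_3w^3+\cdots$. The logarithmic coefficients $\Gamma_n$ of $f^{-1}$ are defined by $\log\frac{f^{-1}(w)}{w}=2\sum_{n=1}^\infty\Gamma_n w^n$ for $w$ near $0$ (branch of the logarithm vanishing at $w=0$). A bound is called sharp if equality holds for at least one function $f$ in the class considered. *)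

theory Defs
  imports "HOL-Complex_Analysis.Complex_Analysis"
begin

text \<open>
  Functions on the unit disk are represented by total functions on the complex plane;
  only their values on \<open>ball 0 1\<close> matter.
\<close>

definition normalized_analytic :: "(complex \<Rightarrow> complex) set" where
  "normalized_analytic = {f. f analytic_on ball 0 1 \<and> f 0 = 0 \<and> deriv f 0 = 1}"

definition normalized_univalent :: "(complex \<Rightarrow> complex) set" where
  "normalized_univalent = {f \<in> normalized_analytic. inj_on f (ball 0 1)}"

definition disk_inverse :: "(complex \<Rightarrow> complex) \<Rightarrow> complex \<Rightarrow> complex" where
  "disk_inverse f = the_inv_into (ball 0 1) f"

text \<open>
  If \<open>g(w) = w + O(w\<^sup>2)\<close>, then \<open>g(w)/w\<close> is close to 1 for small \<open>w\<close>, so there the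
  principal logarithm gives the analytic branch of \<open>log (g(w)/w)\<close> that vanishes at 0.
\<close>

definition log_quotient :: "(complex \<Rightarrow> complex) \<Rightarrow> complex \<Rightarrow> complex" where
  "log_quotient g w = (if w = 0 then 0 else Ln (g w / w))"

text \<open>
  The factor 1/2 comes from the convention that \<open>log (g(w)/w)\<close> is twice the sum of
  \<open>\<Gamma>\<^sub>n w\<^sup>n\<close>, where \<open>g\<close> is the inverse of \<open>f\<close>; see
  \<open>inverse_log_coeff_sums\<close> below.
\<close>

definition inverse_log_coeff :: "(complex \<Rightarrow> complex) \<Rightarrow> nat \<Rightarrow> complex" where
  "inverse_log_coeff f n = fps_nth (fps_expansion (log_quotient (disk_inverse f)) 0) n / 2"

lemma disk_inverse_properties:
  assumes "f \<in> normalized_univalent"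
  shows "open (f ` ball 0 1)" "0 \<in> f ` ball 0 1"
    "disk_inverse f holomorphic_on f ` ball 0 1"
    "disk_inverse f 0 = 0" "deriv (disk_inverse f) 0 = 1"
proof -
  have hol: "f holomorphic_on ball 0 1" and inj: "inj_on f (ball 0 1)"
    and f0: "f 0 = 0" and f1: "deriv f 0 = 1"
    using assms analytic_imp_holomorphic
    by (auto simp: normalized_univalent_def normalized_analytic_def)
  obtain g where g: "g holomorphic_on f ` ball 0 1"
      "\<And>z. z \<in> ball 0 1 \<Longrightarrow> deriv f z * deriv g (f z) = 1"
      "\<And>z. z \<in> ball 0 1 \<Longrightarrow> g (f z) = z"
    using holomorphic_has_inverse[OF hol open_ball inj] by metis
  show op: "open (f ` ball 0 1)"
    using open_mapping_thm3[OF hol open_ball inj] .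
  show in0: "0 \<in> f ` ball 0 1"
    using f0 by (metis centre_in_ball imageI zero_less_one)
  have eq: "disk_inverse f w = g w" if "w \<in> f ` ball 0 1" for w
    using that g(3) the_inv_into_f_f[OF inj] by (auto simp: disk_inverse_def)
  show "disk_inverse f holomorphic_on f ` ball 0 1"
    using g(1) eq by (metis holomorphic_transform)
  show "disk_inverse f 0 = 0"
    using eq[OF in0] g(3)[of 0] f0 by simp
  have "eventually (\<lambda>w. disk_inverse f w = g w) (nhds 0)"
    using eventually_nhds_in_open[OF op in0] by eventually_elim (rule eq)
  hence "deriv (disk_inverse f) 0 = deriv g 0"
    by (rule deriv_cong_ev) simp
  thus "deriv (disk_inverse f) 0 = 1"
    using g(2)[of 0] f0 f1 by simp
qed

lemma log_quotient_sums:
  assumes "open U" "0 \<in> U" "g holomorphic_on U" "g 0 = 0" "deriv g 0 = 1"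
  shows "\<exists>r>0. \<forall>w\<in>ball 0 r.
    (\<lambda>n. fps_nth (fps_expansion (log_quotient g) 0) n * w ^ n) sums log_quotient g w"
proof -
  define h where "h w = (if w = 0 then deriv g 0 else g w / w)" for w
  have h: "h holomorphic_on U"
    using pole_theorem_open_0[OF assms(3,1), of 0 h]
    by (auto simp: h_def assms(4))
  have "isCont h 0"
    using h assms(1,2) by (metis continuous_on_eq_continuous_at holomorphic_on_imp_continuous_on)
  moreover have "h 0 = 1" by (simp add: h_def assms(5))
  ultimately have "eventually (\<lambda>w. h w \<in> ball 1 1) (nhds 0)"
    by (metis centre_in_ball continuous_at_imp_continuous_at_within eventually_nhds isCont_def
        open_ball tendsto_at_iff_tendsto_nhds topological_tendstoD zero_less_one)
  hence "eventually (\<lambda>w. h w \<in> ball 1 1 \<and> w \<in> U) (nhds 0)"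
    using eventually_nhds_in_open[OF assms(1,2)] by (rule eventually_conj)
  then obtain r where r: "r > 0" "\<And>w. w \<in> ball 0 r \<Longrightarrow> h w \<in> ball 1 1 \<and> w \<in> U"
    unfolding eventually_nhds_metric by (auto simp: dist_commute)
  have pos: "h w \<notin> \<real>\<^sub>\<le>\<^sub>0" if "w \<in> ball 0 r" for w
  proof -
    have "norm (1 - h w) < 1" using r(2)[OF that] by (simp add: dist_norm)
    hence "Re (1 - h w) < 1" using complex_Re_le_cmod le_less_trans by blast
    thus ?thesis by (auto simp: complex_nonpos_Reals_iff)
  qed
  have "(\<lambda>w. Ln (h w)) holomorphic_on ball 0 r"
    by (intro holomorphic_on_Ln' holomorphic_on_subset[OF h]) (use r pos in auto)
  moreover have "Ln (h w) = log_quotient g w" for w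
    by (simp add: h_def log_quotient_def assms(5))
  ultimately have "log_quotient g holomorphic_on ball 0 r" by simp
  from holomorphic_power_series[OF this] r(1) show ?thesis
    by (auto simp: fps_expansion_def)
qed

theorem inverse_log_coeff_sums:
  assumes "f \<in> normalized_univalent"
  shows "\<exists>r>0. \<forall>w\<in>ball 0 r - {0}.
    (\<lambda>n. 2 * (inverse_log_coeff f (Suc n) * w ^ Suc n)) sums Ln (disk_inverse f w / w)"
proof -
  obtain r where r: "r > 0" "\<And>w. w \<in> ball 0 r \<Longrightarrow>
    (\<lambda>n. fps_nth (fps_expansion (log_quotient (disk_inverse f)) 0) n * w ^ n)
      sums log_quotient (disk_inverse f) w"
    using log_quotient_sums[OF disk_inverse_properties[OF assms]] by blast
  have "(\<lambda>n. 2 * (inverse_log_coeff f (Suc n) * w ^ Suc n)) sums Ln (disk_inverse f w / w)"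
    if "w \<in> ball 0 r - {0}" for w
    using r(2)[of w] that
    by (subst sums_Suc_iff) (auto simp: inverse_log_coeff_def fps_expansion_def log_quotient_def)
  thus ?thesis using r(1) by blast
qed

end

theory Submission
  imports Defs "HOL-Real_Asymp.Real_Asymp" "HOL-Computational_Algebra.Fundamental_Theorem_Algebra"
begin

text \<open>
  Write \<open>f(z) = z / k(z)\<^sup>2\<close> with \<open>k(z) = 1 + k\<^sub>1 z + k\<^sub>2 z\<^sup>2 + k\<^sub>3 z\<^sup>3 + \<dots>\<close>.  At \<open>w = f(z)\<close> the quotient
  \<open>f\<^sup>-\<^sup>1(w) / w\<close> equals \<open>k(z)\<^sup>2\<close>, and comparing coefficients gives, with
  \<open>\<kappa> = k\<^sub>3 + k\<^sub>1 k\<^sub>2 + k\<^sub>1\<^sup>3 / 3\<close>,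
  \<open>\<Gamma>\<^sub>2 = k\<^sub>2 + (3/2) k\<^sub>1\<^sup>2\<close> and \<open>\<Gamma>\<^sub>3 = \<kappa> + 4 k\<^sub>1 k\<^sub>2 + 3 k\<^sub>1\<^sup>3\<close>
  (\<open>inverse_log_coeff_eq\<close>).  Up to sign, \<open>k\<^sub>1\<close>, \<open>k\<^sub>2\<close> and \<open>\<kappa>\<close> are the Grunsky coefficients
  with indices \<open>(1,1)\<close>, \<open>(1,3)\<close> and \<open>(3,3)\<close> of the odd univalent function
  \<open>h(z) = z / k(z\<^sup>2)\<close>, a square root of \<open>f(z\<^sup>2)\<close>.  Univalence enters only through
  \<open>|k\<^sub>1|\<^sup>2 + 3 |k\<^sub>2|\<^sup>2 \<le> 1\<close> and
  \<open>|\<kappa> + 2 x k\<^sub>2 + x\<^sup>2 k\<^sub>1| \<le> 1/3 + |x|\<^sup>2\<close> for all complex \<open>x\<close>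
  (\<open>Grunsky_first_row\<close>, \<open>Grunsky_quadratic_form\<close>).

  Because \<open>|k\<^sub>1| \<le> 1\<close>, the difference \<open>|\<Gamma>\<^sub>3| - |\<Gamma>\<^sub>2|\<close> is at most
  \<open>|\<Gamma>\<^sub>3 - k\<^sub>1 \<Gamma>\<^sub>2| = |\<kappa> + 3 k\<^sub>1 k\<^sub>2 + (3/2) k\<^sub>1\<^sup>3|\<close>.  For given \<open>k\<^sub>1\<close> and \<open>k\<^sub>2\<close> the quadratic
  form inequality confines \<open>\<kappa>\<close> to an explicit disc; measuring from the centre of that disc turns
  the claim into a polynomial inequality in two real variables (\<open>Grunsky_functional_bound\<close>).
  The Koebe function has \<open>k(z) = 1 - z\<close>, which gives \<open>\<Gamma>\<^sub>2 = 3/2\<close> and \<open>\<Gamma>\<^sub>3 = -10/3\<close>, so the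
  bound is attained.

  The Grunsky inequalities are two instances, \<open>p(u) = u\<close> and \<open>p(u) = u\<^sup>3 + c u\<close>, of an area theorem
  (\<open>area_theorem_poly\<close>): if \<open>p(1/h(z)) = z\<^sup>-\<^sup>N m(z)\<close> with \<open>m = \<Sum> m\<^sub>j z\<^sup>j\<close> holomorphic, then
  \<open>\<Sum> (j - N) |m\<^sub>j|\<^sup>2 \<le> 0\<close>.  By Parseval's formula the weighted sum
  \<open>\<Sum> (j - N) |m\<^sub>j|\<^sup>2 r\<^sup>2\<^sup>j\<close> is a positive multiple of the signed area enclosed by the image
  of \<open>|z| = r\<close> under \<open>p(1/h)\<close>.  That curve winds around no point a positive number of
  times: \<open>p - c\<close> splits into linear factors, and each \<open>1/h - u\<close> has one pole and, by
  injectivity, at most one zero.  A curve with this property encloses nonpositive signed area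
  (\<open>signed_area_nonpos\<close>), since the signed area is the integral of the winding number over the plane.
\<close>

section \<open>The signed area enclosed by a closed curve\<close>

lemma nn_integral_inverse_sqrt_bounded:
  assumes "R > 0" "\<bar>a\<bar> \<le> R"
  shows "(\<integral>\<^sup>+x. ennreal (indicator {-R..R} x / sqrt \<bar>a - x\<bar>) \<partial>lborel) \<le> ennreal (4 * sqrt (2 * R))"
proof -
  \<comment> \<open>By translation and reflection, each side of \<open>a\<close> contributes at most this integral.\<close>
  have half: "(\<integral>\<^sup>+x. ennreal (1 / sqrt x) * indicator {0..2*R} x \<partial>lborel) = ennreal (2 * sqrt (2 * R))"
  proof -
    have "((\<lambda>x. 1 / sqrt x) has_integral (2 * sqrt (2*R) - 2 * sqrt 0)) {0..2*R}"
    proof (rule fundamental_theorem_of_calculus_interior)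
      show "continuous_on {0..2*R} (\<lambda>x. 2 * sqrt x)" by (intro continuous_intros)
      fix x assume "x \<in> {0<..<2*R}"
      then show "((\<lambda>x. 2 * sqrt x) has_vector_derivative 1 / sqrt x) (at x)"
        unfolding has_real_derivative_iff_has_vector_derivative[symmetric]
        by (auto intro!: derivative_eq_intros simp: field_simps)
    qed (use assms in auto)
    from nn_integral_has_integral_lebesgue[OF _ this]
    have "(\<integral>\<^sup>+x. ennreal (indicator {0..2*R} x / sqrt x) \<partial>lborel) = ennreal (2 * sqrt (2 * R))"
      by simp
    moreover have "(\<integral>\<^sup>+x. ennreal (1 / sqrt x) * indicator {0..2*R} x \<partial>lborel) = (\<integral>\<^sup>+x. ennreal (indicator {0..2*R} x / sqrt x) \<partial>lborel)"
      by (intro nn_integral_cong) (auto split: split_indicator)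
    ultimately show ?thesis by simp
  qed
  have "(\<integral>\<^sup>+x. ennreal (indicator {-R..R} x / sqrt \<bar>a - x\<bar>) \<partial>lborel)
    \<le> (\<integral>\<^sup>+x. ennreal (1 / sqrt (x - a)) * indicator {0..2*R} (x - a)
         + ennreal (1 / sqrt (a - x)) * indicator {0..2*R} (a - x) \<partial>lborel)"
    using assms by (intro nn_integral_mono) (auto split: split_indicator)
  also have "\<dots> = (\<integral>\<^sup>+x. ennreal (1 / sqrt (x - a)) * indicator {0..2*R} (x - a) \<partial>lborel)
      + (\<integral>\<^sup>+x. ennreal (1 / sqrt (a - x)) * indicator {0..2*R} (a - x) \<partial>lborel)"
    by (rule nn_integral_add) measurable
  also have "(\<integral>\<^sup>+x. ennreal (1 / sqrt (x - a)) * indicator {0..2*R} (x - a) \<partial>lborel) = ennreal (2 * sqrt (2 * R))"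
    by (subst nn_integral_real_affine[where c=1 and t=a]) (auto simp: half)
  also have "(\<integral>\<^sup>+x. ennreal (1 / sqrt (a - x)) * indicator {0..2*R} (a - x) \<partial>lborel) = ennreal (2 * sqrt (2 * R))"
    by (subst nn_integral_real_affine[where c="-1" and t=a]) (auto simp: half)
  also have "ennreal (2 * sqrt (2 * R)) + ennreal (2 * sqrt (2 * R)) = ennreal (4 * sqrt (2 * R))"
    using assms by (simp flip: ennreal_plus)
  finally show ?thesis .
qed

text \<open>
  The kernel \<open>1/z\<close> is dominated by a product of one-variable integrable functions, so its
  integrability over boxes needs no polar coordinates.
\<close>
lemma norm_inverse_le_sqrt:
  "norm (1 / (z::complex)) \<le> 1 / sqrt \<bar>Re z\<bar> * (1 / sqrt \<bar>Im z\<bar>)" if "Re z \<noteq> 0" "Im z \<noteq> 0"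
proof -
  have "\<bar>Re z\<bar> * \<bar>Im z\<bar> \<le> (norm z)\<^sup>2"
    using sum_squares_bound[of "\<bar>Re z\<bar>" "\<bar>Im z\<bar>"] mult_nonneg_nonneg[OF abs_ge_zero[of "Re z"] abs_ge_zero[of "Im z"]]
    unfolding cmod_power2 power2_abs by linarith
  then have "sqrt \<bar>Re z\<bar> * sqrt \<bar>Im z\<bar> \<le> norm z"
    by (metis norm_ge_zero real_le_lsqrt real_sqrt_mult)
  moreover have "0 < sqrt \<bar>Re z\<bar> * sqrt \<bar>Im z\<bar>" using that by simp
  ultimately show ?thesis by (simp add: norm_divide frac_le)
qed

text \<open>
  Integrating the Cauchy kernel along a vertical segment yields an angle as real part and a
  logarithm of a ratio of distances as imaginary part.  As the segment grows, the angle tends to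
  \<open>\<plusminus> \<pi>\<close>, according to the side on which the pole lies, and the logarithm tends to 0.
\<close>
lemma vertical_integral:
  fixes p q Y :: real
  assumes p: "p \<noteq> 0" and Y: "Y > 0"
  shows "((\<lambda>y. 1 / (Complex p (q - y))) has_integral
     Complex (arctan ((q + Y) / p) - arctan ((q - Y) / p))
        ((ln (p\<^sup>2 + (q - Y)\<^sup>2) - ln (p\<^sup>2 + (q + Y)\<^sup>2)) / 2)) {-Y..Y}"
proof -
  define F where "F y = Complex (- arctan ((q - y) / p)) (ln (p\<^sup>2 + (q - y)\<^sup>2) / 2)" for y
  have pos: "p\<^sup>2 + (q - y)\<^sup>2 > 0" for y using p by (simp add: add_pos_nonneg)
  have "((\<lambda>y. 1 / (Complex p (q - y))) has_integral F Y - F (-Y)) {-Y..Y}"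
  proof (rule fundamental_theorem_of_calculus)
    fix y assume "y \<in> {-Y..Y}"
    have 1: "((\<lambda>y. - arctan ((q - y) / p)) has_real_derivative (p / (p\<^sup>2 + (q - y)\<^sup>2))) (at y)"
      using p pos[of y] by (auto intro!: derivative_eq_intros simp: power_divide field_simps power2_eq_square)
    have 2: "((\<lambda>y. ln (p\<^sup>2 + (q - y)\<^sup>2) / 2) has_real_derivative (- (q - y) / (p\<^sup>2 + (q - y)\<^sup>2))) (at y)"
      using p pos[of y] by (auto intro!: derivative_eq_intros simp: field_simps)
    have "(F has_vector_derivative Complex (p / (p\<^sup>2 + (q - y)\<^sup>2)) (- (q - y) / (p\<^sup>2 + (q - y)\<^sup>2))) (at y)"
      unfolding F_def has_vector_derivative_complex_iff
      using 1 2 by (simp add: has_real_derivative_iff_has_vector_derivative)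
    also have "Complex (p / (p\<^sup>2 + (q - y)\<^sup>2)) (- (q - y) / (p\<^sup>2 + (q - y)\<^sup>2)) = 1 / Complex p (q - y)"
      by (simp add: complex_eq_iff Re_divide Im_divide)
    finally show "(F has_vector_derivative 1 / Complex p (q - y)) (at y within {-Y..Y})"
      by (rule has_vector_derivative_at_within)
  qed (use Y in auto)
  also have "F Y - F (-Y) = Complex (arctan ((q + Y) / p) - arctan ((q - Y) / p))
        ((ln (p\<^sup>2 + (q - Y)\<^sup>2) - ln (p\<^sup>2 + (q + Y)\<^sup>2)) / 2)"
    by (simp add: F_def complex_eq_iff diff_divide_distrib)
  finally show ?thesis .
qed

text \<open>
  A bound independent of \<open>p\<close> and \<open>Y\<close>, for dominated convergence: the difference of two values of
  arctan is at most \<open>\<pi>\<close>, and for \<open>2 |q| \<le> Y\<close> the squared distances to the two ends of the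
  segment differ by a factor of at most 9.
\<close>
lemma vertical_integral_bound:
  fixes p q Y :: real
  assumes p: "p \<noteq> 0" and Y: "Y > 0" "2 * \<bar>q\<bar> \<le> Y"
  shows "norm (Complex (arctan ((q + Y) / p) - arctan ((q - Y) / p))
        ((ln (p\<^sup>2 + (q - Y)\<^sup>2) - ln (p\<^sup>2 + (q + Y)\<^sup>2)) / 2)) \<le> pi + ln 9"
proof -
  have "\<bar>arctan x - arctan y\<bar> \<le> pi" for x y
    using arctan_bounded[of x] arctan_bounded[of y] by linarith
  moreover have "\<bar>ln a - ln b\<bar> \<le> ln 9" if "a > 0" "b > 0" "a \<le> 9 * b" "b \<le> 9 * a" for a b :: real
  proof -
    have "ln a \<le> ln (9 * b)" "ln b \<le> ln (9 * a)" using that by auto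
    then show ?thesis using that by (simp add: ln_mult)
  qed
  moreover have "p\<^sup>2 + (q - Y)\<^sup>2 > 0" "p\<^sup>2 + (q + Y)\<^sup>2 > 0" using p by (simp_all add: add_pos_nonneg)
  moreover have "p\<^sup>2 + (q - Y)\<^sup>2 \<le> 9 * (p\<^sup>2 + (q + Y)\<^sup>2)"
  proof -
    have "\<bar>q - Y\<bar> \<le> \<bar>3 * (q + Y)\<bar>" using Y by (auto simp: abs_if split: if_splits)
    then have "(q - Y)\<^sup>2 \<le> 3\<^sup>2 * (q + Y)\<^sup>2" by (simp only: abs_le_square_iff power_mult_distrib)
    then have "(q - Y)\<^sup>2 \<le> 9 * (q + Y)\<^sup>2" by simp
    then show ?thesis using zero_le_power2[of p] unfolding distrib_left by linarith
  qed
  moreover have "p\<^sup>2 + (q + Y)\<^sup>2 \<le> 9 * (p\<^sup>2 + (q - Y)\<^sup>2)"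
  proof -
    have "\<bar>q + Y\<bar> \<le> \<bar>3 * (q - Y)\<bar>" using Y by (auto simp: abs_if split: if_splits)
    then have "(q + Y)\<^sup>2 \<le> 3\<^sup>2 * (q - Y)\<^sup>2" by (simp only: abs_le_square_iff power_mult_distrib)
    then have "(q + Y)\<^sup>2 \<le> 9 * (q - Y)\<^sup>2" by simp
    then show ?thesis using zero_le_power2[of p] unfolding distrib_left by linarith
  qed
  ultimately have "\<bar>arctan ((q + Y) / p) - arctan ((q - Y) / p)\<bar> \<le> pi"
    and "\<bar>ln (p\<^sup>2 + (q - Y)\<^sup>2) - ln (p\<^sup>2 + (q + Y)\<^sup>2)\<bar> \<le> ln 9" by blast+
  then have "\<bar>arctan ((q + Y) / p) - arctan ((q - Y) / p)\<bar> \<le> pi"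
    and "\<bar>(ln (p\<^sup>2 + (q - Y)\<^sup>2) - ln (p\<^sup>2 + (q + Y)\<^sup>2)) / 2\<bar> \<le> ln 9"
    unfolding abs_divide by simp_all
  moreover have "norm (Complex u v) \<le> r + s" if "\<bar>u\<bar> \<le> r" "\<bar>v\<bar> \<le> s" for u v r s
    using cmod_le[of "Complex u v"] that by simp
  ultimately show ?thesis 
    by blast
qed

lemma vertical_integral_limit:
  fixes p q :: real
  assumes p: "p \<noteq> 0"
  shows "(\<lambda>n. Complex (arctan ((q + real n) / p) - arctan ((q - real n) / p))
        ((ln (p\<^sup>2 + (q - real n)\<^sup>2) - ln (p\<^sup>2 + (q + real n)\<^sup>2)) / 2)) \<longlonglongrightarrow> of_real (pi * sgn p)"
proof -
  have 1: "(\<lambda>n. arctan ((q + real n) / p) - arctan ((q - real n) / p)) \<longlonglongrightarrow> pi * sgn p"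
  proof (cases "p > 0")
    case True
    then show ?thesis by real_asymp
  next
    case False
    then have "p < 0" using p by simp
    then show ?thesis by real_asymp
  qed
  have 2: "(\<lambda>n. (ln (p\<^sup>2 + (q - real n)\<^sup>2) - ln (p\<^sup>2 + (q + real n)\<^sup>2)) / 2) \<longlonglongrightarrow> 0"
    by real_asymp
  show ?thesis using tendsto_Complex[OF 1 2] by (simp add: Complex_eq)
qed

lemma integral_sgn_interval:
  fixes a R :: real
  assumes "\<bar>a\<bar> \<le> R"
  shows "(\<integral>x. indicator {-R..R} x *\<^sub>R sgn (a - x) \<partial>lborel) = 2 * a"
proof -
  have "((\<lambda>x. sgn (a - x)) has_integral (- \<bar>a - R\<bar> - - \<bar>a - (-R)\<bar>)) {-R..R}"
  proof (rule fundamental_theorem_of_calculus_interior_strong[where S="{a}"])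
    show "continuous_on {-R..R} (\<lambda>x. - \<bar>a - x\<bar>)" by (intro continuous_intros)
    fix x assume x: "x \<in> {-R<..<R} - {a}"
    have "((\<lambda>x. - \<bar>a - x\<bar>) has_real_derivative sgn (a - x)) (at x)"
    proof (cases "x < a")
      case True
      show ?thesis
        by (rule has_field_derivative_transform_within_open[of "\<lambda>x. x - a" _ _ "{..<a}"])
           (use True in \<open>auto intro!: derivative_eq_intros\<close>)
    next
      case False
      with x have "x > a" by auto
      show ?thesis
        by (rule has_field_derivative_transform_within_open[of "\<lambda>x. a - x" _ _ "{a<..}"])
           (use \<open>x > a\<close> in \<open>auto intro!: derivative_eq_intros\<close>)
    qed
    then show "((\<lambda>x. - \<bar>a - x\<bar>) has_vector_derivative sgn (a - x)) (at x)"
      by (simp add: has_real_derivative_iff_has_vector_derivative)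
  qed (use assms in auto)
  moreover have "set_integrable lborel {-R..R} (\<lambda>x. sgn (a - x))"
    unfolding set_integrable_def
  proof (rule integrableI_bounded_set_indicator[where B=1])
    show "emeasure lborel {-R..R} < \<infinity>" by (rule emeasure_lborel_Icc_eq[THEN ord_eq_less_trans]) auto
  qed (auto simp: sgn_if)
  ultimately show ?thesis
    using set_borel_integral_eq_integral(2)[of "{-R..R}" "\<lambda>x. sgn (a - x)"] assms
    by (auto simp: set_lebesgue_integral_def dest!: integral_unique)
qed

text \<open>
  The winding number is only controlled off the curve; this is harmless because a differentiable
  curve is a null set in the plane.
\<close>
lemma AE_not_on_curve:
  fixes \<gamma> :: "real \<Rightarrow> complex"
  assumes "\<gamma> differentiable_on {0..1}"
  shows "AE z in lborel \<Otimes>\<^sub>M lborel. of_real (fst z) + \<i> * of_real (snd z) \<notin> \<gamma> ` {0..1}"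
proof -
  let ?g = "\<lambda>t. (Re (\<gamma> t), Im (\<gamma> t))"
  have diff: "?g differentiable_on {0..1}"
    unfolding differentiable_on_def
  proof
    fix x :: real assume "x \<in> {0..1}"
    then obtain D where D: "(\<gamma> has_derivative D) (at x within {0..1})"
      using assms unfolding differentiable_on_def differentiable_def by blast
    show "?g differentiable at x within {0..1}"
      unfolding differentiable_def
      by (rule exI, rule has_derivative_Pair; rule has_derivative_Re[OF D] has_derivative_Im[OF D])
  qed
  then have "negligible (?g ` {0..1})"
    by (rule negligible_differentiable_image_lowdim[rotated]) simp
  moreover have "compact (?g ` {0..1})"
    using diff by (intro compact_continuous_image differentiable_imp_continuous_on) auto
  then have "?g ` {0..1} \<in> sets borel" by (simp add: borel_compact)
  ultimately have "?g ` {0..1} \<in> null_sets lborel"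
    by (simp add: negligible_iff_null_sets null_sets_completion_iff)
  then have "AE z in lborel. z \<notin> ?g ` {0..1}" by (rule AE_not_in)
  then show ?thesis
    unfolding lborel_prod
  proof eventually_elim
    case (elim z)
    show ?case
    proof
      assume "of_real (fst z) + \<i> * of_real (snd z) \<in> \<gamma> ` {0..1}"
      then obtain t where "t \<in> {0..1}" "\<gamma> t = of_real (fst z) + \<i> * of_real (snd z)" by auto
      then have "z = ?g t" by (simp add: prod_eq_iff)
      with elim \<open>t \<in> _\<close> show False by blast
    qed
  qed
qed

text \<open>
  Integrated over \<open>t\<close>, this is \<open>2 \<pi> \<i>\<close> times the winding number about the point \<open>x + \<i> y\<close>, cut off
  to a box; integrated over \<open>(x, y)\<close>, it is the area integral of the Cauchy kernel.  Both orders of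
  integration are compared below.
\<close>
definition cauchy_box :: "(real \<Rightarrow> complex) \<Rightarrow> (real \<Rightarrow> complex) \<Rightarrow> real \<Rightarrow> real \<Rightarrow> real \<times> real \<times> real \<Rightarrow> complex"
  where "cauchy_box \<gamma> \<gamma>' R Y = (\<lambda>(t, x, y). (indicator {0..1} t * indicator {-R..R} x * indicator {-Y..Y} y) *\<^sub>R
            (\<gamma>' t / (\<gamma> t - (of_real x + \<i> * of_real y))))"

lemma integrable_cauchy_box:
  fixes \<gamma> \<gamma>' :: "real \<Rightarrow> complex"
  assumes c: "continuous_on UNIV \<gamma>" "continuous_on UNIV \<gamma>'"
    and R: "R > 0" "\<And>t. t \<in> {0..1} \<Longrightarrow> norm (\<gamma> t) \<le> R"
    and B: "\<And>t. t \<in> {0..1} \<Longrightarrow> norm (\<gamma>' t) \<le> B" and Y: "R \<le> Y"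
  shows "integrable (lborel \<Otimes>\<^sub>M (lborel \<Otimes>\<^sub>M lborel)) (cauchy_box \<gamma> \<gamma>' R Y)"
proof (rule integrableI_bounded)
  have [measurable]: "\<gamma> \<in> borel_measurable borel" "\<gamma>' \<in> borel_measurable borel"
    using c by (auto intro: borel_measurable_continuous_onI)
  show m[measurable]: "cauchy_box \<gamma> \<gamma>' R Y \<in> borel_measurable (lborel \<Otimes>\<^sub>M (lborel \<Otimes>\<^sub>M lborel))"
    unfolding cauchy_box_def by measurable
  have B0: "B \<ge> 0" using order_trans[OF norm_ge_zero B[of 0]] by simp
  define K where "K = ennreal B * (ennreal (4 * sqrt (2 * R)) * ennreal (4 * sqrt (2 * Y)))"
  have inner: "(\<integral>\<^sup>+x. \<integral>\<^sup>+y. ennreal (norm (cauchy_box \<gamma> \<gamma>' R Y (t, x, y))) \<partial>lborel \<partial>lborel) \<le> K * indicator {0..1} t" for t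
  proof (cases "t \<in> {0..1}")
    case t: True
    define a b where "a = Re (\<gamma> t)" and "b = Im (\<gamma> t)"
    have ab: "\<bar>a\<bar> \<le> R" "\<bar>b\<bar> \<le> R" 
      using R(2)[OF t] abs_Re_le_cmod[of "\<gamma> t"] abs_Im_le_cmod[of "\<gamma> t"] by (auto simp: a_def b_def)
    define u where "u x = ennreal (indicator {-R..R} x / sqrt \<bar>a - x\<bar>)" for x
    define v where "v y = ennreal (indicator {-Y..Y} y / sqrt \<bar>b - y\<bar>)" for y
    have [measurable]: "u \<in> borel_measurable borel" "v \<in> borel_measurable borel"
      unfolding u_def v_def by measurable
    have "AE y in lborel. ennreal (norm (cauchy_box \<gamma> \<gamma>' R Y (t, x, y))) \<le> ennreal B * (u x * v y)"
      if "x \<noteq> a" for x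
      using AE_lborel_singleton[of b]
    proof eventually_elim
      case (elim y)
      have "norm (\<gamma>' t / (\<gamma> t - (of_real x + \<i> * of_real y))) 
          = norm (\<gamma>' t) * norm (1 / (\<gamma> t - (of_real x + \<i> * of_real y)))"
        by (simp add: norm_divide)
      also have "\<dots> \<le> B * (1 / sqrt \<bar>a - x\<bar> * (1 / sqrt \<bar>b - y\<bar>))"
        using norm_inverse_le_sqrt[of "\<gamma> t - (of_real x + \<i> * of_real y)"] that elim B[OF t] B0
        by (intro mult_mono) (auto simp: a_def b_def)
      finally have *: "norm (\<gamma>' t / (\<gamma> t - (of_real x + \<i> * of_real y))) \<le> B * (1 / sqrt \<bar>a - x\<bar> * (1 / sqrt \<bar>b - y\<bar>))" .
      have "ennreal B * (u x * v y) = ennreal (B * ((indicator {-R..R} x / sqrt \<bar>a - x\<bar>) * (indicator {-Y..Y} y / sqrt \<bar>b - y\<bar>)))"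
        unfolding u_def v_def using B0 by (simp flip: ennreal_mult)
      then show ?case
        using * t by (auto simp: cauchy_box_def split: split_indicator intro!: ennreal_leI)
    qed
    then have "(\<integral>\<^sup>+y. ennreal (norm (cauchy_box \<gamma> \<gamma>' R Y (t, x, y))) \<partial>lborel) \<le> (\<integral>\<^sup>+y. ennreal B * (u x * v y) \<partial>lborel)"
      if "x \<noteq> a" for x using that by (intro nn_integral_mono_AE) auto
    then have "(\<integral>\<^sup>+x. \<integral>\<^sup>+y. ennreal (norm (cauchy_box \<gamma> \<gamma>' R Y (t, x, y))) \<partial>lborel \<partial>lborel)
        \<le> (\<integral>\<^sup>+x. \<integral>\<^sup>+y. ennreal B * (u x * v y) \<partial>lborel \<partial>lborel)"
      using AE_lborel_singleton[of a] by (intro nn_integral_mono_AE) (auto elim!: eventually_mono)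
    also have "\<dots> = ennreal B * (integral\<^sup>N lborel u * integral\<^sup>N lborel v)"
      by (simp add: nn_integral_cmult nn_integral_multc)
    also have "\<dots> \<le> K"
      unfolding K_def u_def v_def using ab R Y
      by (intro mult_mono nn_integral_inverse_sqrt_bounded) auto
    finally show ?thesis using t by simp
  qed (simp add: cauchy_box_def)
  have sf: "sigma_finite_measure (lborel \<Otimes>\<^sub>M lborel :: (real \<times> real) measure)"
    unfolding lborel_prod by (rule sigma_finite_lborel)
  have "(\<integral>\<^sup>+z. ennreal (norm (cauchy_box \<gamma> \<gamma>' R Y z)) \<partial>(lborel \<Otimes>\<^sub>M (lborel \<Otimes>\<^sub>M lborel)))
      = (\<integral>\<^sup>+t. \<integral>\<^sup>+xy. ennreal (norm (cauchy_box \<gamma> \<gamma>' R Y (t, xy))) \<partial>(lborel \<Otimes>\<^sub>M lborel) \<partial>lborel)"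
    by (subst sigma_finite_measure.nn_integral_fst[OF sf, symmetric]) auto
  also have "\<dots> = (\<integral>\<^sup>+t. \<integral>\<^sup>+x. \<integral>\<^sup>+y. ennreal (norm (cauchy_box \<gamma> \<gamma>' R Y (t, x, y))) \<partial>lborel \<partial>lborel \<partial>lborel)"
    by (subst lborel.nn_integral_fst[symmetric]) auto
  also have "\<dots> \<le> (\<integral>\<^sup>+t. K * indicator {0..1} (t::real) \<partial>lborel)"
    by (intro nn_integral_mono inner)
  also have "\<dots> = K" by (simp add: nn_integral_cmult)
  also have "\<dots> < \<infinity>" by (simp add: K_def ennreal_mult_less_top)
  finally show "(\<integral>\<^sup>+z. ennreal (norm (cauchy_box \<gamma> \<gamma>' R Y z)) \<partial>(lborel \<Otimes>\<^sub>M (lborel \<Otimes>\<^sub>M lborel))) < \<infinity>" .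
qed

text \<open>
  The area integral of \<open>1 / (w - c)\<close>, with \<open>w = a + \<i> b\<close>, over the points \<open>c\<close> of the box
  \<open>[-R, R] \<times> [-n, n]\<close> tends to \<open>2 \<pi> a\<close>:
  a vertical line at \<open>x\<close> contributes \<open>\<pi> sgn (a - x)\<close>.  Thus, integrating over the parameters
  \<open>c\<close>, one recovers the coordinate of the curve from its winding numbers.
\<close>
lemma box_integral_Cauchy_kernel:
  fixes a b R :: real
  assumes ab: "\<bar>a\<bar> \<le> R" "\<bar>b\<bar> \<le> R" and R: "R > 0"
  defines "J \<equiv> \<lambda>n x. \<integral>y. (indicator {-real n..real n} y :: real) *\<^sub>R (1 / Complex (a - x) (b - y)) \<partial>lborel"
  shows "(\<lambda>n. \<integral>x. (indicator {-R..R} x :: real) *\<^sub>R J n x \<partial>lborel) \<longlonglongrightarrow> of_real (2 * pi * a)"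
    and "2 * R \<le> real n \<Longrightarrow> norm (\<integral>x. (indicator {-R..R} x :: real) *\<^sub>R J n x \<partial>lborel) \<le> (pi + ln 9) * (2 * R)"
proof -
  have [measurable]: "(\<lambda>(x, y). Complex (a - x) (b - y)) \<in> borel_measurable (lborel \<Otimes>\<^sub>M lborel)"
    unfolding Complex_eq by measurable
  have [measurable]: "J n \<in> borel_measurable lborel" for n
    unfolding J_def by measurable
  have J: "J n x = Complex (arctan ((b + real n) / (a - x)) - arctan ((b - real n) / (a - x)))
        ((ln ((a - x)\<^sup>2 + (b - real n)\<^sup>2) - ln ((a - x)\<^sup>2 + (b + real n)\<^sup>2)) / 2)" 
    if "x \<noteq> a" "n > 0" for x n
  proof -
    have "continuous_on {-real n..real n} (\<lambda>y. 1 / Complex (a - x) (b - y))"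
      unfolding Complex_eq using that
      by (intro continuous_intros) (auto simp: complex_eq_iff)
    then have "set_integrable lborel {-real n..real n} (\<lambda>y. 1 / Complex (a - x) (b - y))"
      by (rule borel_integrable_atLeastAtMost')
    from set_borel_integral_eq_integral(2)[OF this] vertical_integral[of "a - x" "real n" b] that
    show ?thesis by (simp add: J_def set_lebesgue_integral_def integral_unique)
  qed
  have bound: "norm (J n x) \<le> pi + ln 9" if "x \<noteq> a" "2 * R \<le> real n" for x n
  proof -
    have "0 < real n" "2 * \<bar>b\<bar> \<le> real n" using that R ab by linarith+
    then show ?thesis using J[of x n] vertical_integral_bound[of "a - x" "real n" b] that by simp
  qed
  have iR: "integrable lborel (\<lambda>x. indicator {-R..R} x * (pi + ln 9) :: real)"
    by (intro integrable_mult_left integrable_real_indicator) (auto simp: emeasure_lborel_Icc_eq)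
  have lim: "(\<lambda>n. J n x) \<longlonglongrightarrow> of_real (pi * sgn (a - x))" if "x \<noteq> a" for x
    by (rule Lim_transform_eventually[OF vertical_integral_limit])
       (use that in \<open>auto intro!: eventually_sequentiallyI[of 1] simp: J\<close>)
  obtain N where N: "2 * R \<le> real N" using real_arch_simple by blast
  have "(\<lambda>n. \<integral>x. (indicator {-R..R} x :: real) *\<^sub>R J (n + N) x \<partial>lborel) \<longlonglongrightarrow> (\<integral>x. (indicator {-R..R} x :: real) *\<^sub>R complex_of_real (pi * sgn (a - x)) \<partial>lborel)"
  proof (rule integral_dominated_convergence[OF _ _ iR])
    show "AE x in lborel. (\<lambda>n. (indicator {-R..R} x :: real) *\<^sub>R J (n + N) x) \<longlonglongrightarrow> (indicator {-R..R} x :: real) *\<^sub>R complex_of_real (pi * sgn (a - x))"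
      using AE_lborel_singleton[of a]
      by eventually_elim (intro tendsto_intros LIMSEQ_ignore_initial_segment lim, simp)
    show "AE x in lborel. norm ((indicator {-R..R} x :: real) *\<^sub>R J (n + N) x) \<le> indicator {-R..R} x * (pi + ln 9)" for n
      using AE_lborel_singleton[of a]
      by eventually_elim (use N bound[of _ "n + N"] in \<open>auto split: split_indicator\<close>)
  qed auto
  also have "(\<integral>x. (indicator {-R..R} x :: real) *\<^sub>R complex_of_real (pi * sgn (a - x)) \<partial>lborel)
     = of_real (\<integral>x. pi * (indicator {-R..R} x *\<^sub>R sgn (a - x)) \<partial>lborel)"
    by (subst integral_complex_of_real[symmetric]) (simp add: scaleR_conv_of_real mult_ac)
  also have "\<dots> = of_real (2 * pi * a)"
    using integral_sgn_interval[OF ab(1)] by simp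
  finally show "(\<lambda>n. \<integral>x. (indicator {-R..R} x :: real) *\<^sub>R J n x \<partial>lborel) \<longlonglongrightarrow> of_real (2 * pi * a)"
    by (rule LIMSEQ_offset)
  show "norm (\<integral>x. (indicator {-R..R} x :: real) *\<^sub>R J n x \<partial>lborel) \<le> (pi + ln 9) * (2 * R)" if n: "2 * R \<le> real n"
  proof -
    have ae: "AE x in lborel. norm ((indicator {-R..R} x :: real) *\<^sub>R J n x) \<le> indicator {-R..R} x * (pi + ln 9)"
      using AE_lborel_singleton[of a]
      by eventually_elim (use n bound[of _ n] in \<open>auto split: split_indicator\<close>)
    have "norm (\<integral>x. (indicator {-R..R} x :: real) *\<^sub>R J n x \<partial>lborel)
        \<le> (\<integral>x. norm ((indicator {-R..R} x :: real) *\<^sub>R J n x) \<partial>lborel)"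
      by (rule integral_norm_bound)
    also have "\<dots> \<le> (\<integral>x. indicator {-R..R} x * (pi + ln 9) \<partial>lborel)"
      by (rule integral_mono_AE'[OF iR ae]) simp
    also have "\<dots> = (pi + ln 9) * (2 * R)" using R by simp
    finally show ?thesis .
  qed
qed

text \<open>
  If \<open>\<gamma>\<close> is closed, then the imaginary part of \<open>\<integral> \<gamma>' / (\<gamma> - c)\<close> is \<open>2 \<pi>\<close> times the winding number
  about \<open>c\<close> and \<open>\<integral> x dy\<close> is the enclosed signed area.  Integrating the former over the box
  \<open>[-R, R] \<times> [-n, n]\<close> of points \<open>c\<close> gives a nonpositive number.  By Fubini's theorem and
  \<open>box_integral_Cauchy_kernel\<close>, this number tends to \<open>2 \<pi> \<integral> x dy\<close> as \<open>n\<close> grows.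
\<close>
lemma signed_area_nonpos:
  fixes \<gamma> \<gamma>' :: "real \<Rightarrow> complex"
  assumes der: "\<And>t. (\<gamma> has_vector_derivative \<gamma>' t) (at t)"
    and cont': "continuous_on UNIV \<gamma>'"
    and W: "\<And>c. c \<notin> \<gamma> ` {0..1} \<Longrightarrow> Im (integral {0..1} (\<lambda>t. \<gamma>' t / (\<gamma> t - c))) \<le> 0"
  shows "integral {0..1} (\<lambda>t. Re (\<gamma> t) * Im (\<gamma>' t)) \<le> 0"
proof -
  have cont: "continuous_on UNIV \<gamma>"
    using der by (meson continuous_at_imp_continuous_on has_vector_derivative_continuous)
  have [measurable]: "\<gamma> \<in> borel_measurable borel" "\<gamma>' \<in> borel_measurable borel"
    using cont cont' by (auto intro: borel_measurable_continuous_onI)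
  have "compact (\<gamma> ` {0..1})" "compact (\<gamma>' ` {0..1})"
    by (intro compact_continuous_image continuous_on_subset[OF cont] continuous_on_subset[OF cont']; simp)+
  then have "bounded (\<gamma> ` {0..1})" "bounded (\<gamma>' ` {0..1})" by (auto intro: compact_imp_bounded)
  then obtain R B where R: "R > 0" "\<And>t. t \<in> {0..1} \<Longrightarrow> norm (\<gamma> t) \<le> R"
    and B: "\<And>t. t \<in> {0..1} \<Longrightarrow> norm (\<gamma>' t) \<le> B"
    unfolding bounded_pos by (metis imageI)
  have B0: "B \<ge> 0" using order_trans[OF norm_ge_zero B[of 0]] by simp
  have Rt: "\<bar>Re (\<gamma> t)\<bar> \<le> R" "\<bar>Im (\<gamma> t)\<bar> \<le> R" if "t \<in> {0..1}" for t
    using R(2)[OF that] abs_Re_le_cmod[of "\<gamma> t"] abs_Im_le_cmod[of "\<gamma> t"] by auto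
  define f where "f n = cauchy_box \<gamma> \<gamma>' R (real n)" for n
  have [measurable]: "f n \<in> borel_measurable (lborel \<Otimes>\<^sub>M (lborel \<Otimes>\<^sub>M lborel))" for n
    unfolding f_def cauchy_box_def by measurable
  have intf: "integrable (lborel \<Otimes>\<^sub>M (lborel \<Otimes>\<^sub>M lborel)) (f n)" if "2 * R \<le> real n" for n
    unfolding f_def using R that by (intro integrable_cauchy_box[OF cont cont' R B]) auto
  interpret P: pair_sigma_finite "lborel :: real measure" "lborel \<Otimes>\<^sub>M lborel :: (real \<times> real) measure"
    by (simp add: lborel_prod lborel_pair.pair_sigma_finite_axioms)

  define I where "I n = integral\<^sup>L (lborel \<Otimes>\<^sub>M (lborel \<Otimes>\<^sub>M lborel)) (f n)" for n
  have neg: "Im (I n) \<le> 0" if n: "2 * R \<le> real n" for n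
  proof -
    have int2: "integrable (lborel \<Otimes>\<^sub>M lborel) (\<lambda>xy. \<integral>t. f n (t, xy) \<partial>lborel)"
      using P.integrable_snd[of "\<lambda>t xy. f n (t, xy)"] intf[OF n] by simp
    have "I n = (\<integral>xy. \<integral>t. f n (t, xy) \<partial>lborel \<partial>(lborel \<Otimes>\<^sub>M lborel))"
      using P.integral_snd[of "\<lambda>t xy. f n (t, xy)"] intf[OF n] by (simp add: I_def)
    then have "Im (I n) = (\<integral>xy. Im (\<integral>t. f n (t, xy) \<partial>lborel) \<partial>(lborel \<Otimes>\<^sub>M lborel))"
      using integral_Im[OF int2] by simp
    moreover have "0 \<le> (\<integral>xy. - Im (\<integral>t. f n (t, xy) \<partial>lborel) \<partial>(lborel \<Otimes>\<^sub>M lborel))"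
    proof (rule integral_nonneg_AE)
      have "\<gamma> differentiable_on {0..1}"
        using der by (meson differentiable_at_imp_differentiable_on differentiableI_vector)
      from AE_not_on_curve[OF this]
      show "AE xy in lborel \<Otimes>\<^sub>M lborel. 0 \<le> - Im (\<integral>t. f n (t, xy) \<partial>lborel)"
      proof eventually_elim
        case (elim z)
        define c where "c = of_real (fst z) + \<i> * of_real (snd z)"
        define s where "s = (indicator {-R..R} (fst z) * indicator {-real n..real n} (snd z) :: real)"
        have "continuous_on {0..1} (\<lambda>t. \<gamma>' t / (\<gamma> t - c))"
        proof (intro continuous_intros continuous_on_subset[OF cont] continuous_on_subset[OF cont'] ballI)
          fix t :: real assume "t \<in> {0..1}"
          then show "\<gamma> t - c \<noteq> 0" using elim unfolding c_def by (metis imageI right_minus_eq)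
        qed auto
        then have "set_integrable lborel {0..1} (\<lambda>t. \<gamma>' t / (\<gamma> t - c))"
          by (rule borel_integrable_atLeastAtMost')
        from set_borel_integral_eq_integral(2)[OF this]
        have "(\<integral>t. indicator {0..1} t *\<^sub>R (\<gamma>' t / (\<gamma> t - c)) \<partial>lborel) = integral {0..1} (\<lambda>t. \<gamma>' t / (\<gamma> t - c))"
          by (simp add: set_lebesgue_integral_def)
        moreover have "(\<integral>t. f n (t, z) \<partial>lborel) = s *\<^sub>R (\<integral>t. indicator {0..1} t *\<^sub>R (\<gamma>' t / (\<gamma> t - c)) \<partial>lborel)"
          by (subst integral_scaleR_right[symmetric])
             (auto simp: f_def cauchy_box_def s_def c_def case_prod_beta mult_ac intro!: Bochner_Integration.integral_cong)
        moreover have "s \<ge> 0" by (simp add: s_def)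
        ultimately show ?case using W[of c] elim
          by (simp add: c_def mult_nonneg_nonpos)
      qed
    qed
    ultimately show ?thesis by simp
  qed

  define K where "K n t = (\<integral>x. (indicator {-R..R} x :: real) *\<^sub>R 
     (\<integral>y. (indicator {-real n..real n} y :: real) *\<^sub>R (1 / Complex (Re (\<gamma> t) - x) (Im (\<gamma> t) - y)) \<partial>lborel) \<partial>lborel)" for n t
  have fK: "(\<integral>x. \<integral>y. f n (t, x, y) \<partial>lborel \<partial>lborel) = (indicator {0..1} t :: real) *\<^sub>R (\<gamma>' t * K n t)" for n t
  proof -
    have "f n (t, x, y) = ((indicator {0..1} t :: real) *\<^sub>R \<gamma>' t) * ((indicator {-R..R} x :: real) *\<^sub>R 
            ((indicator {-real n..real n} y :: real) *\<^sub>R (1 / Complex (Re (\<gamma> t) - x) (Im (\<gamma> t) - y))))" for x y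
    proof -
      have "\<gamma> t - (of_real x + \<i> * of_real y) = Complex (Re (\<gamma> t) - x) (Im (\<gamma> t) - y)"
        by (simp add: complex_eq_iff)
      then show ?thesis by (simp add: f_def cauchy_box_def scaleR_conv_of_real)
    qed
    then show ?thesis
      by (simp only: K_def integral_mult_right_zero integral_scaleR_right mult_scaleR_left)
  qed
  have I_eq: "I n = (\<integral>t. (indicator {0..1} t :: real) *\<^sub>R (\<gamma>' t * K n t) \<partial>lborel)" if n: "2 * R \<le> real n" for n
  proof -
    have "I n = (\<integral>t. \<integral>xy. f n (t, xy) \<partial>(lborel \<Otimes>\<^sub>M lborel) \<partial>lborel)"
      unfolding I_def by (rule P.integral_fst'[OF intf[OF n], symmetric])
    also have "\<dots> = (\<integral>t. \<integral>x. \<integral>y. f n (t, x, y) \<partial>lborel \<partial>lborel \<partial>lborel)"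
    proof (intro integral_cong_AE)
      show "AE t in lborel. (\<integral>xy. f n (t, xy) \<partial>(lborel \<Otimes>\<^sub>M lborel)) = (\<integral>x. \<integral>y. f n (t, x, y) \<partial>lborel \<partial>lborel)"
        using P.AE_integrable_fst'[OF intf[OF n]]
        by eventually_elim (rule lborel_pair.integral_fst'[symmetric])
    qed auto
    finally show ?thesis by (simp add: fK)
  qed
  obtain N where N: "2 * R \<le> real N" using real_arch_simple by blast
  have lim: "(\<lambda>n. I (n + N)) \<longlonglongrightarrow> (\<integral>t. (indicator {0..1} t :: real) *\<^sub>R (\<gamma>' t * of_real (2 * pi * Re (\<gamma> t))) \<partial>lborel)"
  proof -
    have iB: "integrable lborel (\<lambda>t::real. indicator {0..1} t * (B * ((pi + ln 9) * (2 * R))) :: real)"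
      by (intro integrable_mult_left integrable_real_indicator) (auto simp: emeasure_lborel_Icc_eq)
    have [measurable]: "(\<lambda>(t, x, y). Complex (Re (\<gamma> t) - x) (Im (\<gamma> t) - y)) \<in> borel_measurable (lborel \<Otimes>\<^sub>M lborel \<Otimes>\<^sub>M lborel)"
      unfolding Complex_eq by measurable
    have [measurable]: "K n \<in> borel_measurable lborel" for n
      unfolding K_def Complex_eq by measurable
    have "(\<lambda>n. \<integral>t. (indicator {0..1} t :: real) *\<^sub>R (\<gamma>' t * K (n + N) t) \<partial>lborel) \<longlonglongrightarrow> (\<integral>t. (indicator {0..1} t :: real) *\<^sub>R (\<gamma>' t * of_real (2 * pi * Re (\<gamma> t))) \<partial>lborel)"
    proof (rule integral_dominated_convergence[OF _ _ iB])
      show "AE t in lborel. (\<lambda>n. (indicator {0..1} t :: real) *\<^sub>R (\<gamma>' t * K (n + N) t)) \<longlonglongrightarrow> (indicator {0..1} t :: real) *\<^sub>R (\<gamma>' t * of_real (2 * pi * Re (\<gamma> t)))"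
      proof (rule AE_I2)
        fix t :: real
        show "(\<lambda>n. (indicator {0..1} t :: real) *\<^sub>R (\<gamma>' t * K (n + N) t)) \<longlonglongrightarrow> (indicator {0..1} t :: real) *\<^sub>R (\<gamma>' t * of_real (2 * pi * Re (\<gamma> t)))"
        proof (cases "t \<in> {0..1}")
          case True
          show ?thesis
            using box_integral_Cauchy_kernel(1)[OF Rt[OF True] R(1)]
            by (intro tendsto_intros LIMSEQ_ignore_initial_segment[where f="\<lambda>n. K n t"]) (simp add: K_def)
        qed simp
      qed
      show "AE t in lborel. norm ((indicator {0..1} t :: real) *\<^sub>R (\<gamma>' t * K (n + N) t)) \<le> indicator {0..1} t * (B * ((pi + ln 9) * (2 * R)))" for n
      proof (rule AE_I2)
        fix t :: real
        show "norm ((indicator {0..1} t :: real) *\<^sub>R (\<gamma>' t * K (n + N) t)) \<le> indicator {0..1} t * (B * ((pi + ln 9) * (2 * R)))"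
        proof (cases "t \<in> {0..1}")
          case True
          have "norm (K (n + N) t) \<le> (pi + ln 9) * (2 * R)"
            unfolding K_def using N by (intro box_integral_Cauchy_kernel(2) Rt True R(1)) simp
          then have "norm (\<gamma>' t * K (n + N) t) \<le> B * ((pi + ln 9) * (2 * R))"
            unfolding norm_mult using B[OF True] B0 by (intro mult_mono) auto
          then show ?thesis using True by simp
        qed simp
      qed
    qed auto
    moreover have "I (n + N) = (\<integral>t. (indicator {0..1} t :: real) *\<^sub>R (\<gamma>' t * K (n + N) t) \<partial>lborel)" for n
      using N by (intro I_eq) simp
    ultimately show ?thesis by simp
  qed
  have "set_integrable lborel {0..1} (\<lambda>t. \<gamma>' t * of_real (2 * pi * Re (\<gamma> t)))"
    by (intro borel_integrable_atLeastAtMost' continuous_intros continuous_on_subset[OF cont] continuous_on_subset[OF cont']) auto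
  from set_borel_integral_eq_integral[OF this]
  have int: "(\<lambda>t. \<gamma>' t * of_real (2 * pi * Re (\<gamma> t))) integrable_on {0..1}"
   and eq: "(\<integral>t. (indicator {0..1} t :: real) *\<^sub>R (\<gamma>' t * of_real (2 * pi * Re (\<gamma> t))) \<partial>lborel) = integral {0..1} (\<lambda>t. \<gamma>' t * of_real (2 * pi * Re (\<gamma> t)))"
    by (simp_all add: set_lebesgue_integral_def)
  have "Im (integral {0..1} (\<lambda>t. \<gamma>' t * of_real (2 * pi * Re (\<gamma> t)))) \<le> 0"
    unfolding eq[symmetric]
    by (rule tendsto_upperbound[OF tendsto_Im[OF lim]]) (use neg N in auto)
  also have "Im (integral {0..1} (\<lambda>t. \<gamma>' t * of_real (2 * pi * Re (\<gamma> t)))) = integral {0..1} (\<lambda>t. (2 * pi) * (Re (\<gamma> t) * Im (\<gamma>' t)))"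
    using integral_linear[OF int bounded_linear_Im] by (simp add: o_def mult_ac)
  finally show ?thesis using pi_gt_zero by (simp add: mult_le_0_iff)
qed

text \<open>
  The hypothesis is invariant under rotating the curve by a right angle, which turns \<open>\<integral> x dy\<close>
  into \<open>- \<integral> y dx\<close>.  The sum of the two integrals has the form to which Parseval's formula applies.
\<close>
corollary signed_area_nonpos_complex:
  fixes \<gamma> \<gamma>' :: "real \<Rightarrow> complex"
  assumes der: "\<And>t. (\<gamma> has_vector_derivative \<gamma>' t) (at t)"
    and cont': "continuous_on UNIV \<gamma>'"
    and W: "\<And>c. c \<notin> \<gamma> ` {0..1} \<Longrightarrow> Im (integral {0..1} (\<lambda>t. \<gamma>' t / (\<gamma> t - c))) \<le> 0"
  shows "Im (integral {0..1} (\<lambda>t. cnj (\<gamma> t) * \<gamma>' t)) \<le> 0"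
proof -
  have cont: "continuous_on UNIV \<gamma>"
    using der by (meson continuous_at_imp_continuous_on has_vector_derivative_continuous)
  have 1: "integral {0..1} (\<lambda>t. Re (\<gamma> t) * Im (\<gamma>' t)) \<le> 0"
    by (rule signed_area_nonpos[OF der cont' W])
  have "integral {0..1} (\<lambda>t. Re (\<i> * \<gamma> t) * Im (\<i> * \<gamma>' t)) \<le> 0"
  proof (rule signed_area_nonpos)
    show "((\<lambda>t. \<i> * \<gamma> t) has_vector_derivative \<i> * \<gamma>' t) (at t)" for t
      using der[of t] by (rule has_vector_derivative_mult_right)
    show "continuous_on UNIV (\<lambda>t. \<i> * \<gamma>' t)" by (intro continuous_intros cont')
    fix c assume c: "c \<notin> (\<lambda>t. \<i> * \<gamma> t) ` {0..1}"
    have "- \<i> * c \<notin> \<gamma> ` {0..1}"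
    proof
      assume "- \<i> * c \<in> \<gamma> ` {0..1}"
      then obtain t where "t \<in> {0..1}" "\<gamma> t = - \<i> * c" by auto
      then have "c = \<i> * \<gamma> t" by simp
      with c \<open>t \<in> {0..1}\<close> show False by blast
    qed
    moreover have "\<i> * \<gamma>' t / (\<i> * \<gamma> t - c) = \<gamma>' t / (\<gamma> t - (- \<i> * c))" for t
    proof -
      have "\<i> * \<gamma> t - c = \<i> * (\<gamma> t - (- \<i> * c))" by (simp add: algebra_simps)
      then show ?thesis by simp
    qed
    ultimately show "Im (integral {0..1} (\<lambda>t. \<i> * \<gamma>' t / (\<i> * \<gamma> t - c))) \<le> 0"
      using W by presburger
  qed
  then have 2: "integral {0..1} (\<lambda>t. - (Im (\<gamma> t) * Re (\<gamma>' t))) \<le> 0" by simp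
  have i1: "(\<lambda>t. Re (\<gamma> t) * Im (\<gamma>' t)) integrable_on {0..1}"
    and i2: "(\<lambda>t. - (Im (\<gamma> t) * Re (\<gamma>' t))) integrable_on {0..1}"
    and i3: "(\<lambda>t. cnj (\<gamma> t) * \<gamma>' t) integrable_on {0..1}"
    by (intro integrable_continuous_real continuous_intros continuous_on_subset[OF cont] continuous_on_subset[OF cont']; simp)+
  have "Im (integral {0..1} (\<lambda>t. cnj (\<gamma> t) * \<gamma>' t)) 
      = integral {0..1} (\<lambda>t. Re (\<gamma> t) * Im (\<gamma>' t) + - (Im (\<gamma> t) * Re (\<gamma>' t)))"
    using integral_linear[OF i3 bounded_linear_Im] by (simp add: o_def)
  also have "\<dots> \<le> 0"
    using 1 2 by (subst integral_add[OF i1 i2]) simp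
  finally show ?thesis .
qed

section \<open>Winding of polynomials in the reciprocal of a univalent function\<close>

lemma sphere_subset_unit_ball: "0 < r \<Longrightarrow> r < 1 \<Longrightarrow> sphere (0::complex) r \<subseteq> ball 0 1"
  by (auto simp: dist_norm)

lemma vector_derivative_circlepath_origin:
  assumes "t \<in> {0..1}"
  shows "vector_derivative (circlepath 0 r) (at t within {0..1}) = 2 * pi * \<i> * circlepath 0 r t"
proof -
  have "circlepath 0 r t = r * exp (2 * of_real pi * \<i> * t)"
    by (simp add: circlepath)
  then show ?thesis
    using assms by (simp add: vector_derivative_circlepath01)
qed

text \<open>
  The number \<open>k\<close> counts the zeros of \<open>f\<close> inside the circle.  An injective function has at most one
  zero, and that zero is simple; dividing it out leaves a zero-free function whose
  logarithmic derivative integrates to 0.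
\<close>
lemma log_deriv_integral_injective:
  fixes f :: "complex \<Rightarrow> complex"
  assumes f: "f holomorphic_on ball 0 1" "inj_on f (ball 0 1)" and r: "0 < r" "r < 1"
    and nz: "\<And>z. z \<in> sphere 0 r \<Longrightarrow> f z \<noteq> 0"
  shows "\<exists>k::real. 0 \<le> k \<and> k \<le> 1 \<and> (f 0 = 0 \<longrightarrow> k = 1) \<and>
    ((\<lambda>z. deriv f z / f z) has_contour_integral (2 * pi * \<i> * k)) (circlepath 0 r)"
proof -
  have image: "path_image (circlepath 0 r) = sphere 0 r" using r by (simp add: path_image_circlepath_nonneg)
  have zero: "((\<lambda>z. deriv F z / F z) has_contour_integral 0) (circlepath 0 r)"
    if "F holomorphic_on ball 0 1" "\<And>z. z \<in> cball 0 r \<Longrightarrow> F z \<noteq> 0" for F :: "complex \<Rightarrow> complex"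
  proof (rule Cauchy_theorem_convex[where S="cball 0 r" and K="{}"])
    have sub: "cball 0 r \<subseteq> ball (0::complex) 1" using r by auto
    have hol: "(\<lambda>z. deriv F z / F z) holomorphic_on ball 0 1 \<inter> {z. F z \<noteq> 0}"
      by (intro holomorphic_intros holomorphic_deriv holomorphic_on_subset[OF that(1)]
          holomorphic_on_subset[OF holomorphic_deriv[OF that(1) open_ball]]) auto
    then show "continuous_on (cball 0 r) (\<lambda>z. deriv F z / F z)"
      by (intro holomorphic_on_imp_continuous_on, elim holomorphic_on_subset) (use sub that in auto)
    have "open (ball 0 1 \<inter> {z. F z \<noteq> 0})"
      using continuous_open_preimage[OF holomorphic_on_imp_continuous_on[OF that(1)] open_ball, of "-{0}"]
      by (simp add: Int_def vimage_def open_Compl)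
    then show "(\<lambda>z. deriv F z / F z) field_differentiable at x" if "x \<in> interior (cball 0 r) - {}" for x
      using hol that \<open>\<And>z. z \<in> cball 0 r \<Longrightarrow> F z \<noteq> 0\<close> sub interior_subset[of "cball 0 r"]
      by (intro holomorphic_on_imp_differentiable_at[OF hol]) (use r in auto)
  qed (use r image in auto)
  \<comment> \<open>Either there is a zero inside, to be divided out, or \<open>f\<close> is zero-free on the closed disc.\<close>
  show ?thesis
  proof (cases "\<exists>a\<in>ball 0 r. f a = 0")
    case True
    then obtain a where a: "a \<in> ball 0 r" "f a = 0" by blast
    have a1: "a \<in> ball 0 1" using a r by auto
    define F where "F z = (if z = a then deriv f a else f z / (z - a))" for z
    have F: "F holomorphic_on ball 0 1"
      using pole_theorem_open_0[OF f(1) open_ball, of a F] a by (auto simp: F_def)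
    have fF: "f z = (z - a) * F z" for z using a by (auto simp: F_def)
    have F0: "F z \<noteq> 0" if "z \<in> ball 0 1" for z
    proof (cases "z = a")
      case True
      then show ?thesis
        using holomorphic_injective_imp_regular[OF f(1) open_ball f(2) a1] by (simp add: F_def)
    next
      case False
      then have "f z \<noteq> f a" using f(2) that a1 by (metis inj_onD)
      then show ?thesis using False a(2) by (simp add: F_def)
    qed
    have 1: "((\<lambda>z. 1 / (z - a)) has_contour_integral 2 * pi * \<i>) (circlepath 0 r)"
      using Cauchy_integral_circlepath_simple[of "\<lambda>_. 1" 0 r a] a by simp
    have 2: "((\<lambda>z. deriv F z / F z) has_contour_integral 0) (circlepath 0 r)"
      using r by (intro zero F F0) auto
    have "((\<lambda>z. deriv f z / f z) has_contour_integral 2 * pi * \<i> * 1) (circlepath 0 r)"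
    proof (rule has_contour_integral_eq)
      show "((\<lambda>z. 1 / (z - a) + deriv F z / F z) has_contour_integral 2 * pi * \<i> * 1) (circlepath 0 r)"
        using has_contour_integral_add[OF 1 2] by simp
      fix z assume "z \<in> path_image (circlepath 0 r)"
      then have z: "z \<in> sphere 0 r" using image by blast
      then have z1: "z \<in> ball 0 1" "z \<noteq> a" using r a by auto
      have "f = (\<lambda>z. (z - a) * F z)" using fF by auto
      then have "deriv f z = (z - a) * deriv F z + F z"
        using holomorphic_derivI[OF F open_ball z1(1), of UNIV]
        by (auto intro!: DERIV_imp_deriv derivative_eq_intros)
      then show "1 / (z - a) + deriv F z / F z = deriv f z / f z"
        using z1 F0[OF z1(1)] by (simp add: fF field_simps)
    qed
    then show ?thesis by (intro exI[of _ 1]) auto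
  next
    case False
    have "((\<lambda>z. deriv f z / f z) has_contour_integral 0) (circlepath 0 r)"
    proof (rule zero[OF f(1)])
      fix z :: complex assume "z \<in> cball 0 r"
      then show "f z \<noteq> 0" using nz[of z] False by (cases "norm z = r") auto
    qed
    then show ?thesis using False r by (intro exI[of _ 0]) auto
  qed
qed

text \<open>
  Inside the circle \<open>1/h - u\<close> has a simple pole at the origin and at most one zero.  For
  \<open>u \<noteq> 0\<close>, its logarithmic derivative is that of \<open>h - 1/u\<close> minus that of \<open>h\<close>.
\<close>
lemma log_deriv_integral_reciprocal:
  fixes h :: "complex \<Rightarrow> complex"
  assumes h: "h holomorphic_on ball 0 1" "inj_on h (ball 0 1)" "h 0 = 0" and r: "0 < r" "r < 1"
    and nz: "\<And>z. z \<in> sphere 0 r \<Longrightarrow> 1 / h z \<noteq> u"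
  shows "\<exists>k::real. k \<le> 0 \<and>
    ((\<lambda>z. deriv (\<lambda>z. 1 / h z) z / (1 / h z - u)) has_contour_integral (2 * pi * \<i> * k)) (circlepath 0 r)"
proof -
  have image: "path_image (circlepath 0 r) = sphere 0 r" using r by (simp add: path_image_circlepath_nonneg)
  have hz: "h z \<noteq> 0" if "z \<in> sphere 0 r" for z
    using that h(2,3) r sphere_subset_unit_ball[OF r] by (metis centre_in_ball inj_onD less_numeral_extra(1) mem_sphere_0 norm_zero order_less_irrefl subsetD)
  have dz: "h field_differentiable at z" if "z \<in> sphere 0 r" for z
    using that h r by (auto intro: holomorphic_on_imp_differentiable_at)
  have dg: "deriv (\<lambda>z. 1 / h z) z = - deriv h z / (h z)\<^sup>2" if "z \<in> sphere 0 r" for z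
    using dz[OF that] hz[OF that] by (simp add: divide_inverse deriv_inverse power2_eq_square) 
  have 1: "((\<lambda>z. deriv h z / h z) has_contour_integral (2 * pi * \<i>)) (circlepath 0 r)"
    using log_deriv_integral_injective[OF h(1,2) r hz] h(3) by auto
  show ?thesis
  proof (cases "u = 0")
    case True
    have "((\<lambda>z. deriv (\<lambda>z. 1 / h z) z / (1 / h z - u)) has_contour_integral - (2 * pi * \<i>)) (circlepath 0 r)"
    proof (rule has_contour_integral_eq[OF has_contour_integral_neg[OF 1]])
      fix z assume "z \<in> path_image (circlepath 0 r)"
      then have z: "z \<in> sphere 0 r" using image by blast
      show "- (deriv h z / h z) = deriv (\<lambda>z. 1 / h z) z / (1 / h z - u)"
        using hz[OF z] by (simp add: dg[OF z] True power2_eq_square)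
    qed
    then show ?thesis by (intro exI[of _ "-1"]) auto
  next
    case False
    have h': "(\<lambda>z. h z - 1 / u) holomorphic_on ball 0 1" "inj_on (\<lambda>z. h z - 1 / u) (ball 0 1)"
      using h by (auto intro!: holomorphic_intros simp: inj_on_def)
    have nz': "h z - 1 / u \<noteq> 0" if "z \<in> sphere 0 r" for z
      using nz[OF that] by auto
    obtain k :: real where k: "k \<le> 1" 
      "((\<lambda>z. deriv (\<lambda>z. h z - 1 / u) z / (h z - 1 / u)) has_contour_integral (2 * pi * \<i> * k)) (circlepath 0 r)"
      using log_deriv_integral_injective[OF h' r nz'] by auto
    have "((\<lambda>z. deriv (\<lambda>z. 1 / h z) z / (1 / h z - u)) has_contour_integral (2 * pi * \<i> * k - 2 * pi * \<i>)) (circlepath 0 r)"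
    proof (rule has_contour_integral_eq[OF has_contour_integral_diff[OF k(2) 1]])
      fix z assume "z \<in> path_image (circlepath 0 r)"
      then have z: "z \<in> sphere 0 r" using image by blast
      have "deriv (\<lambda>z. h z - 1 / u) z = deriv h z" using dz[OF z] by (simp add: deriv_diff)
      moreover have "u * h z \<noteq> 1" using nz'[OF z] False by (auto simp: field_simps)
      ultimately show "deriv (\<lambda>z. h z - 1 / u) z / (h z - 1 / u) - deriv h z / h z = deriv (\<lambda>z. 1 / h z) z / (1 / h z - u)"
        using nz'[OF z] nz[OF z] hz[OF z] False
        by (simp add: dg[OF z] divide_simps power2_eq_square) (simp add: algebra_simps)
    qed
    then show ?thesis using k(1) by (intro exI[of _ "k - 1"]) (auto simp: algebra_simps)
  qed
qed

text \<open>
  The logarithmic derivative of \<open>q(1/h)\<close> is the sum of those of its linear factors, so no winding number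
  of a curve \<open>p(1/h)\<close> is positive.
\<close>
lemma log_deriv_integral_poly_reciprocal:
  fixes h :: "complex \<Rightarrow> complex" and q :: "complex poly"
  assumes h: "h holomorphic_on ball 0 1" "inj_on h (ball 0 1)" "h 0 = 0" and r: "0 < r" "r < 1"
    and nz: "\<And>z. z \<in> sphere 0 r \<Longrightarrow> poly q (1 / h z) \<noteq> 0"
  shows "\<exists>k::real. k \<le> 0 \<and>
    ((\<lambda>z. poly (pderiv q) (1 / h z) * deriv (\<lambda>z. 1 / h z) z / poly q (1 / h z)) has_contour_integral (2 * pi * \<i> * k)) (circlepath 0 r)"
  using nz
proof (induction "degree q" arbitrary: q)
  case 0
  then have "pderiv q = 0" by (simp add: pderiv_eq_0_iff)
  then show ?case by (intro exI[of _ 0]) (simp add: has_contour_integral_0)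
next
  case (Suc n)
  then have "degree q \<noteq> 0" by simp
  then obtain u where "poly q u = 0"
    using alg_closed_imp_poly_has_root[of q] by auto
  then obtain s where q: "q = [:-u, 1:] * s" by (auto simp: poly_eq_0_iff_dvd)
  have s0: "s \<noteq> 0" using \<open>degree q \<noteq> 0\<close> q by auto
  then have deg: "n = degree s" using Suc(2) by (simp add: q degree_mult_eq del: mult_pCons_left)
  have nz1: "1 / h z \<noteq> u" and nz2: "poly s (1 / h z) \<noteq> 0" if "z \<in> sphere 0 r" for z
    using Suc(3)[OF that] by (auto simp: q)
  obtain k :: real where k: "k \<le> 0" "((\<lambda>z. deriv (\<lambda>z. 1 / h z) z / (1 / h z - u)) has_contour_integral (2 * pi * \<i> * k)) (circlepath 0 r)"
    using log_deriv_integral_reciprocal[OF h r nz1] by auto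
  obtain l :: real where l: "l \<le> 0" "((\<lambda>z. poly (pderiv s) (1 / h z) * deriv (\<lambda>z. 1 / h z) z / poly s (1 / h z)) has_contour_integral (2 * pi * \<i> * l)) (circlepath 0 r)"
    using Suc(1)[OF deg nz2] by auto
  have "((\<lambda>z. poly (pderiv q) (1 / h z) * deriv (\<lambda>z. 1 / h z) z / poly q (1 / h z)) has_contour_integral 
     2 * pi * \<i> * k + 2 * pi * \<i> * l) (circlepath 0 r)"
  proof (rule has_contour_integral_eq[OF has_contour_integral_add[OF k(2) l(2)]])
    fix z assume "z \<in> path_image (circlepath 0 r)"
    then have z: "z \<in> sphere 0 r" using r path_image_circlepath_nonneg[of r 0] by auto
    define g where "g = 1 / h z"
    have "poly (pderiv q) g = poly ([:-u, 1:] * pderiv s + pderiv [:-u, 1:] * s) g"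
      unfolding q pderiv_mult by (simp only: add.commute mult.commute)
    also have "\<dots> = (g - u) * poly (pderiv s) g + poly s g"
      by (simp add: pderiv_pCons algebra_simps)
    finally have e2: "poly (pderiv q) g = (g - u) * poly (pderiv s) g + poly s g" .
    have e1: "poly q g = (g - u) * poly s g"
      by (simp add: q algebra_simps)
    have "g \<noteq> u" "poly s g \<noteq> 0" using nz1[OF z] nz2[OF z] by (auto simp: g_def)
    then show "deriv (\<lambda>z. 1 / h z) z / (1 / h z - u) + poly (pderiv s) (1 / h z) * deriv (\<lambda>z. 1 / h z) z / poly s (1 / h z) =
         poly (pderiv q) (1 / h z) * deriv (\<lambda>z. 1 / h z) z / poly q (1 / h z)"
      unfolding g_def[symmetric] e1 e2 by (simp add: divide_simps) (simp add: algebra_simps)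
  qed
  then show ?case using k(1) l(1) by (intro exI[of _ "k + l"]) (auto simp: algebra_simps)
qed

section \<open>The area theorem\<close>

lemma Parseval_circle:
  fixes m n :: "complex \<Rightarrow> complex"
  assumes m: "m holomorphic_on ball 0 1" "m has_fps_expansion M"
    and n: "n holomorphic_on ball 0 1" "n has_fps_expansion L" and r: "0 < r" "r < 1"
  shows "(\<lambda>j. cnj (fps_nth M j) * fps_nth L j * of_real (r ^ (2 * j))) sums
    integral {0..1} (\<lambda>t. cnj (m (circlepath 0 r t)) * n (circlepath 0 r t))"
proof -
  have sph: "circlepath 0 r t \<in> sphere 0 r" for t
    using r by (simp add: circlepath norm_mult)
  have contc: "continuous_on A (circlepath 0 r)" for A
    unfolding circlepath by (intro continuous_intros)
  have contn: "continuous_on A (\<lambda>t. n (circlepath 0 r t))" for A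
    by (rule continuous_on_compose2[OF holomorphic_on_imp_continuous_on[OF n(1)] contc])
       (use sph sphere_subset_unit_ball[OF r] in auto)
  have coeff: "fps_nth M j = (deriv ^^ j) m 0 / fact j" "fps_nth L j = (deriv ^^ j) n 0 / fact j" for j
    using fps_nth_fps_expansion[OF m(2)] fps_nth_fps_expansion[OF n(2)] by auto
  have msums: "(\<lambda>j. fps_nth M j * z ^ j) sums m z" if "z \<in> ball 0 1" for z
    using holomorphic_power_series[OF m(1) that] by (simp add: coeff)
  have "uniform_limit (cball 0 r) (\<lambda>N z. \<Sum>j<N. fps_nth M j * (z - 0) ^ j) (\<lambda>z. suminf (\<lambda>j. fps_nth M j * (z - 0) ^ j)) sequentially"
  proof (rule powser_uniform_limit)
    have eq: "norm (complex_of_real ((r + 1) / 2)) = (r + 1) / 2"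
      using r by (subst norm_of_real, intro abs_of_nonneg) simp
    then have "complex_of_real ((r + 1) / 2) \<in> ball 0 1"
      unfolding mem_ball_0 eq using r by simp
    then have "summable (\<lambda>j. fps_nth M j * complex_of_real ((r + 1) / 2) ^ j)"
      using msums sums_summable by blast
    then have "ereal ((r + 1) / 2) \<le> conv_radius (fps_nth M)"
      using conv_radius_geI[of "fps_nth M" "complex_of_real ((r + 1) / 2)"] unfolding eq by blast
    moreover have "ereal r < ereal ((r + 1) / 2)" using r by simp
    ultimately show "ereal r < conv_radius (fps_nth M)" by (rule less_le_trans[rotated])
  qed
  then have "uniform_limit (cball 0 r) (\<lambda>N z. \<Sum>j<N. fps_nth M j * z ^ j) m sequentially"
    by (rule uniform_limit_cong'[THEN iffD1, rotated 2]) (use r msums in \<open>auto simp: sums_iff\<close>)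
  then have "uniform_limit {0..1} (\<lambda>N t. \<Sum>j<N. fps_nth M j * circlepath 0 r t ^ j) (\<lambda>t. m (circlepath 0 r t)) sequentially"
    by (rule uniform_limit_compose') (use sph in auto)
  then have "uniform_limit {0..1} (\<lambda>N t. cnj (\<Sum>j<N. fps_nth M j * circlepath 0 r t ^ j)) (\<lambda>t. cnj (m (circlepath 0 r t))) sequentially"
    by (rule bounded_linear.uniform_limit[OF bounded_linear_cnj])
  then have ul: "uniform_limit {0..1} (\<lambda>N t. cnj (\<Sum>j<N. fps_nth M j * circlepath 0 r t ^ j) * n (circlepath 0 r t)) (\<lambda>t. cnj (m (circlepath 0 r t)) * n (circlepath 0 r t)) sequentially"
    by (rule uniform_lim_mult[OF _ uniform_limit_const])
       (auto intro!: compact_imp_bounded compact_continuous_image contn contc continuous_intros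
          continuous_on_compose2[OF holomorphic_on_imp_continuous_on[OF m(1)] contc]
          subsetD[OF sphere_subset_unit_ball[OF r]] sph)
  have coef: "((\<lambda>t. cnj (circlepath 0 r t ^ j) * n (circlepath 0 r t)) has_integral of_real (r ^ (2 * j)) * fps_nth L j) {0..1}" for j
  proof -
    define w where "w = 2 * complex_of_real pi * \<i>"
    have w: "w \<noteq> 0" by (simp add: w_def)
    have "((\<lambda>u. n u / (u-0) ^ (Suc j)) has_contour_integral ((2 * pi * \<i>) / (fact j) * (deriv ^^ j) n 0)) (circlepath 0 r)"
      by (rule Cauchy_has_contour_integral_higher_derivative_circlepath)
         (use r in \<open>auto intro!: holomorphic_on_imp_continuous_on holomorphic_on_subset[OF n(1)]\<close>)
    then have "((\<lambda>t. n (circlepath 0 r t) / (circlepath 0 r t) ^ Suc j * (w * circlepath 0 r t)) has_integral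
        (w * fps_nth L j)) {0..1}"
      unfolding has_contour_integral_def coeff w_def
      by (rule has_integral_eq_rhs[OF has_integral_eq, rotated])
         (auto simp: vector_derivative_circlepath_origin)
    from has_integral_mult_right[OF this, of "of_real (r ^ (2 * j)) / w"]
    show ?thesis
    proof (rule has_integral_eq_rhs[OF has_integral_eq, rotated])
      fix t :: real
      define z where "z = circlepath 0 r t"
      have "z \<noteq> 0" using sph[of t] r by (auto simp: z_def)
      moreover have "cnj z * z = of_real (r\<^sup>2)" using sph[of t] by (simp add: z_def complex_norm_square[symmetric] mult.commute)
      then have "of_real (r ^ (2 * j)) = cnj z ^ j * z ^ j"
        by (metis of_real_power power_mult power_mult_distrib)
      ultimately show "of_real (r ^ (2 * j)) / w * (n (circlepath 0 r t) / (circlepath 0 r t) ^ Suc j * (w * circlepath 0 r t))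
         = cnj (circlepath 0 r t ^ j) * n (circlepath 0 r t)"
        unfolding z_def[symmetric] using w by (simp add: field_simps)
    qed (use w in auto)
  qed
  obtain I J where IJ: "\<And>N. ((\<lambda>t. cnj (\<Sum>j<N. fps_nth M j * circlepath 0 r t ^ j) * n (circlepath 0 r t)) has_integral I N) {0..1}"
    "((\<lambda>t. cnj (m (circlepath 0 r t)) * n (circlepath 0 r t)) has_integral J) {0..1}" "I \<longlonglongrightarrow> J"
    by (rule uniform_limit_integral[OF ul]) (auto intro!: continuous_intros contn contc)
  have "((\<lambda>t. \<Sum>j<N. cnj (fps_nth M j) * (cnj (circlepath 0 r t ^ j) * n (circlepath 0 r t))) has_integral
          (\<Sum>j<N. cnj (fps_nth M j) * (of_real (r ^ (2 * j)) * fps_nth L j))) {0..1}" for N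
    by (intro has_integral_sum has_integral_mult_right coef) auto
  moreover have "(\<lambda>t. \<Sum>j<N. cnj (fps_nth M j) * (cnj (circlepath 0 r t ^ j) * n (circlepath 0 r t)))
      = (\<lambda>t. cnj (\<Sum>j<N. fps_nth M j * circlepath 0 r t ^ j) * n (circlepath 0 r t))" for N
    by (simp add: sum_distrib_right mult.assoc)
  ultimately have I: "I N = (\<Sum>j<N. cnj (fps_nth M j) * (of_real (r ^ (2 * j)) * fps_nth L j))" for N
    by (intro has_integral_unique[OF IJ(1)[of N]]) (simp only:)
  have "I = (\<lambda>N. \<Sum>j<N. cnj (fps_nth M j) * (of_real (r ^ (2 * j)) * fps_nth L j))"
    by (rule ext) (rule I)
  with IJ(3) have "(\<lambda>N. \<Sum>j<N. cnj (fps_nth M j) * (of_real (r ^ (2 * j)) * fps_nth L j)) \<longlonglongrightarrow> J"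
    by (simp only:)
  then show ?thesis
    unfolding sums_def integral_unique[OF IJ(2)] by (simp add: mult_ac)
qed

text \<open>
  On the circle \<open>|z| = r\<close> the function \<open>Q = p(1/h) = z\<^sup>-\<^sup>N m\<close> satisfies
  \<open>cnj Q \<cdot> z Q' = r\<^sup>-\<^sup>2\<^sup>N cnj m \<cdot> (z m' - N m)\<close>, and \<open>z m' - N m\<close> has the coefficients
  \<open>(j - N) m\<^sub>j\<close>.  So the signed area of the image curve is a multiple of \<open>\<Sum> (j - N) |m\<^sub>j|\<^sup>2 r\<^sup>2\<^sup>j\<close>.
  Its terms with \<open>j > N\<close> are nonnegative and may be truncated before \<open>r\<close> tends to 1.
\<close>
theorem area_theorem_poly:
  fixes h m :: "complex \<Rightarrow> complex" and p :: "complex poly"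
  assumes h: "h holomorphic_on ball 0 1" "inj_on h (ball 0 1)" "h 0 = 0"
    and m: "m holomorphic_on ball 0 1" "m has_fps_expansion M"
    and eq: "\<And>z. z \<in> ball 0 1 - {0} \<Longrightarrow> m z = z ^ N * poly p (1 / h z)"
    and J: "N \<le> J"
  shows "(\<Sum>j\<le>J. (real j - real N) * (norm (fps_nth M j))\<^sup>2) \<le> 0"
proof -
  define n where "n z = z * deriv m z - of_nat N * m z" for z
  have n: "n holomorphic_on ball 0 1" 
    unfolding n_def by (intro holomorphic_intros m holomorphic_deriv) auto
  define L where "L = fps_X * fps_deriv M - fps_const (of_nat N) * M"
  have nL: "n has_fps_expansion L"
    unfolding n_def L_def by (intro fps_expansion_intros m)
  have L: "fps_nth L j = (of_nat j - of_nat N) * fps_nth M j" for j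
    by (cases j) (simp_all add: L_def algebra_simps)
  have bound: "(\<Sum>j\<le>J. (real j - real N) * (norm (fps_nth M j))\<^sup>2 * r ^ (2 * j)) \<le> 0" if r: "0 < r" "r < 1" for r
  proof -
    let ?c = "circlepath 0 r"
    have sph: "?c t \<in> sphere 0 r" for t using r by (simp add: circlepath norm_mult)
    have sb: "?c t \<in> ball 0 1" "?c t \<noteq> 0" for t using sph[of t] r by auto
    have image: "path_image ?c = sphere 0 r" using r by (simp add: path_image_circlepath_nonneg)
    have h0: "h z \<noteq> 0" if "z \<in> ball 0 1" "z \<noteq> 0" for z
      using that h by (metis centre_in_ball inj_onD zero_less_one)
    define Q where "Q z = poly p (1 / h z)" for z
    define Q' where "Q' z = poly (pderiv p) (1 / h z) * deriv (\<lambda>z. 1 / h z) z" for z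
    have dQ: "(Q has_field_derivative Q' z) (at z)" if z: "z \<in> ball 0 1" "z \<noteq> 0" for z
    proof -
      have "(h has_field_derivative deriv h z) (at z)"
        using holomorphic_derivI[OF h(1) open_ball z(1), of UNIV] by simp
      then have "((\<lambda>z. 1 / h z) has_field_derivative - deriv h z / (h z)\<^sup>2) (at z)"
        using h0[OF z] by (auto intro!: derivative_eq_intros simp: power2_eq_square)
      then have "((\<lambda>z. 1 / h z) has_field_derivative deriv (\<lambda>z. 1 / h z) z) (at z)"
        by (metis DERIV_imp_deriv)
      then show ?thesis unfolding Q_def Q'_def by (rule DERIV_chain2[OF poly_DERIV])
    qed
    have zQ: "z ^ N * (z * Q' z) = n z" "z ^ N * Q z = m z" if z: "z \<in> ball 0 1" "z \<noteq> 0" for z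
    proof -
      show mz: "z ^ N * Q z = m z" using eq[of z] z by (simp add: Q_def)
      have "(m has_field_derivative of_nat N * z ^ (N - 1) * Q z + z ^ N * Q' z) (at z)"
      proof (rule has_field_derivative_transform_within_open[where S="ball 0 1 - {0}"])
        show "((\<lambda>z. z ^ N * Q z) has_field_derivative of_nat N * z ^ (N - 1) * Q z + z ^ N * Q' z) (at z)"
          by (rule derivative_eq_intros dQ z refl)+ (simp add: mult_ac)
      qed (use z eq in \<open>auto simp: Q_def\<close>)
      then have "deriv m z = of_nat N * z ^ (N - 1) * Q z + z ^ N * Q' z" by (rule DERIV_imp_deriv)
      then have "n z = of_nat N * (z * z ^ (N - 1)) * Q z + z ^ N * (z * Q' z) - of_nat N * (z ^ N * Q z)"
        unfolding n_def by (simp add: algebra_simps flip: mz)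
      moreover have "of_nat N * (z * z ^ (N - 1)) = of_nat N * z ^ N" by (cases N) auto
      ultimately show "z ^ N * (z * Q' z) = n z" by (cases "N = 0") auto
    qed
    define \<gamma> where "\<gamma> t = Q (?c t)" for t
    define \<gamma>' where "\<gamma>' t = 2 * pi * \<i> * (?c t * Q' (?c t))" for t
    have contc: "continuous_on UNIV ?c" unfolding circlepath by (intro continuous_intros)
    have neg: "Im (integral {0..1} (\<lambda>t. cnj (\<gamma> t) * \<gamma>' t)) \<le> 0"
    proof (rule signed_area_nonpos_complex)
      show "(\<gamma> has_vector_derivative \<gamma>' t) (at t)" for t
      proof -
        have "(?c has_vector_derivative 2 * pi * \<i> * ?c t) (at t)"
          using has_vector_derivative_circlepath[of 0 r t UNIV] by (simp add: circlepath mult_ac)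
        from field_vector_diff_chain_at[OF this dQ[OF sb]]
        show ?thesis by (simp add: \<gamma>_def[abs_def] \<gamma>'_def o_def mult_ac)
      qed
      have "\<gamma>' = (\<lambda>t. 2 * pi * \<i> * (n (?c t) / ?c t ^ N))"
        using zQ(1)[OF sb] sb(2) by (auto simp: \<gamma>'_def fun_eq_iff field_simps)
      moreover have "continuous_on UNIV (\<lambda>t. n (?c t))"
        by (rule continuous_on_compose2[OF holomorphic_on_imp_continuous_on[OF n] contc]) (use sb in auto)
      ultimately show "continuous_on UNIV \<gamma>'"
        using sb(2) by (auto intro!: continuous_intros contc)
      fix c assume c: "c \<notin> \<gamma> ` {0..1}"
      define q where "q = p - [:c:]"
      have "poly q (1 / h z) \<noteq> 0" if "z \<in> sphere 0 r" for z
      proof -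
        have "z \<in> ?c ` {0..1}" using that image unfolding path_image_def by blast
        then obtain t where "t \<in> {0..1}" "z = ?c t" by blast
        then show ?thesis using c by (auto simp: q_def \<gamma>_def Q_def)
      qed
      from log_deriv_integral_poly_reciprocal[OF h r this] obtain k :: real where k: "k \<le> 0"
        "((\<lambda>z. poly (pderiv q) (1 / h z) * deriv (\<lambda>z. 1 / h z) z / poly q (1 / h z)) has_contour_integral (2 * pi * \<i> * k)) ?c"
        by blast
      have "((\<lambda>t. \<gamma>' t / (\<gamma> t - c)) has_integral (2 * pi * \<i> * k)) {0..1}"
        using k(2) unfolding has_contour_integral_def
      proof (rule has_integral_eq[rotated])
        fix t :: real assume t: "t \<in> {0..1}"
        have "pderiv q = pderiv p" by (simp add: q_def pderiv_diff pderiv_pCons)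
        then show "poly (pderiv q) (1 / h (?c t)) * deriv (\<lambda>z. 1 / h z) (?c t) / poly q (1 / h (?c t)) * vector_derivative ?c (at t within {0..1}) = \<gamma>' t / (\<gamma> t - c)"
          using t by (simp add: vector_derivative_circlepath_origin \<gamma>'_def \<gamma>_def Q'_def Q_def q_def mult_ac)
      qed
      then show "Im (integral {0..1} (\<lambda>t. \<gamma>' t / (\<gamma> t - c))) \<le> 0"
        using k(1) by (simp add: integral_unique mult_nonneg_nonpos)
    qed
    \<comment> \<open>The area in terms of \<open>m\<close> and \<open>z m' - N m\<close> only: on the circle, \<open>|z|\<close> is constant.\<close>
    define P where "P = integral {0..1} (\<lambda>t. cnj (m (?c t)) * n (?c t))"
    have "integral {0..1} (\<lambda>t. cnj (\<gamma> t) * \<gamma>' t) = integral {0..1} (\<lambda>t. (2 * pi * \<i> / of_real (r ^ (2 * N))) * (cnj (m (?c t)) * n (?c t)))"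
    proof (rule integral_cong)
      fix t :: real
      define z where "z = ?c t"
      have z: "z \<in> ball 0 1" "z \<noteq> 0" using sb by (auto simp: z_def)
      have "cnj z * z = of_real (r\<^sup>2)" using sph[of t] by (simp add: z_def complex_norm_square[symmetric] mult.commute)
      then have rN: "of_real (r ^ (2 * N)) = cnj z ^ N * z ^ N"
        by (metis of_real_power power_mult power_mult_distrib)
      show "cnj (\<gamma> t) * \<gamma>' t = (2 * pi * \<i> / of_real (r ^ (2 * N))) * (cnj (m (?c t)) * n (?c t))"
        unfolding \<gamma>_def \<gamma>'_def z_def[symmetric] rN zQ[OF z, symmetric] using z by simp
    qed
    also have "\<dots> = (2 * pi * \<i> / of_real (r ^ (2 * N))) * P" by (simp add: P_def)
    also have "\<dots> = of_real (2 * pi / r ^ (2 * N)) * (\<i> * P)" by simp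
    finally have int: "integral {0..1} (\<lambda>t. cnj (\<gamma> t) * \<gamma>' t) = of_real (2 * pi / r ^ (2 * N)) * (\<i> * P)" .
    have Im_scale: "Im (of_real c * w) = c * Im w" for c w by simp
    have "(2 * pi / r ^ (2 * N)) * Re P \<le> 0"
      using neg unfolding int Im_scale by simp
    moreover have "2 * pi / r ^ (2 * N) > 0" using r by simp
    ultimately have "Re P \<le> 0" by (meson mult_pos_pos not_le)
    have "(\<lambda>j. cnj (fps_nth M j) * fps_nth L j * of_real (r ^ (2 * j))) sums P"
      unfolding P_def by (rule Parseval_circle[OF m n nL r])
    moreover have "cnj (fps_nth M j) * fps_nth L j * of_real (r ^ (2 * j)) = of_real ((real j - real N) * (norm (fps_nth M j))\<^sup>2 * r ^ (2 * j))" for j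
    proof -
      have "cnj (fps_nth M j) * fps_nth L j = (of_nat j - of_nat N) * (fps_nth M j * cnj (fps_nth M j))"
        by (simp add: L mult_ac)
      then show ?thesis by (simp add: complex_norm_square[symmetric])
    qed
    ultimately have "(\<lambda>j. complex_of_real ((real j - real N) * (norm (fps_nth M j))\<^sup>2 * r ^ (2 * j))) sums P"
      by (simp only:)
    from sums_Re[OF this] have s: "(\<lambda>j. (real j - real N) * (norm (fps_nth M j))\<^sup>2 * r ^ (2 * j)) sums Re P"
      by simp
    have "(\<Sum>j\<le>J. (real j - real N) * (norm (fps_nth M j))\<^sup>2 * r ^ (2 * j)) \<le> Re P"
      unfolding sums_unique[OF s] using J r
      by (intro sum_le_suminf[OF sums_summable[OF s]]) auto
    then show ?thesis using \<open>Re P \<le> 0\<close> by linarith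
  qed
  have "((\<lambda>r. \<Sum>j\<le>J. (real j - real N) * (norm (fps_nth M j))\<^sup>2 * r ^ (2 * j)) \<longlongrightarrow>
     (\<Sum>j\<le>J. (real j - real N) * (norm (fps_nth M j))\<^sup>2 * 1 ^ (2 * j))) (at_left 1)"
    by (intro tendsto_intros)
  moreover have "eventually (\<lambda>r. (\<Sum>j\<le>J. (real j - real N) * (norm (fps_nth M j))\<^sup>2 * r ^ (2 * j)) \<le> 0) (at_left (1::real))"
    using eventually_at_left_real[of 0 "1::real"] by (rule eventually_mono) (auto intro!: bound)
  ultimately have "(\<Sum>j\<le>J. (real j - real N) * (norm (fps_nth M j))\<^sup>2 * 1 ^ (2 * j)) \<le> 0"
    by (rule tendsto_upperbound) simp
  then show ?thesis by simp
qed

section \<open>Grunsky inequalities\<close>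

text \<open>
  The quotient \<open>f(z)/z\<close> has no zeros, hence a holomorphic square root on the disc; \<open>k\<close> is the
  reciprocal of that root.
\<close>
lemma inverse_square_root_factor:
  assumes f: "f holomorphic_on ball 0 1" "inj_on f (ball 0 1)" "f 0 = 0" "deriv f 0 = 1"
  obtains k where "k holomorphic_on ball 0 1" "k 0 = 1" "\<And>z. z \<in> ball 0 1 \<Longrightarrow> f z * (k z)\<^sup>2 = z"
proof -
  define \<phi> where "\<phi> z = (if z = 0 then deriv f 0 else f z / z)" for z
  have hol: "\<phi> holomorphic_on ball 0 1"
    using pole_theorem_open_0[OF f(1) open_ball, of 0 \<phi>] f by (auto simp: \<phi>_def)
  have nz: "\<phi> z \<noteq> 0" if "z \<in> ball 0 1" for z
    using f that inj_onD[OF f(2), of z 0] by (auto simp: \<phi>_def)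
  obtain s where s: "s holomorphic_on ball 0 1" "\<And>z. z \<in> ball 0 1 \<Longrightarrow> \<phi> z = (s z)\<^sup>2"
    using contractible_imp_holomorphic_sqrt[OF hol convex_imp_contractible[OF convex_ball] nz] by metis
  have s0: "(s 0)\<^sup>2 = 1" using s(2)[of 0] f by (simp add: \<phi>_def)
  have sz: "s z \<noteq> 0" if "z \<in> ball 0 1" for z using nz[OF that] s(2)[OF that] by auto
  show thesis
  proof
    show "(\<lambda>z. s 0 / s z) holomorphic_on ball 0 1"
      using sz by (intro holomorphic_intros s) auto
    show "s 0 / s 0 = 1" using sz[of 0] by simp
    show "f z * (s 0 / s z)\<^sup>2 = z" if z: "z \<in> ball 0 1" for z
      using s(2)[OF z] nz[OF z] f s0 by (auto simp: \<phi>_def power_divide field_simps split: if_splits)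
  qed
qed

text \<open>
  Working with \<open>k\<close> instead of \<open>f\<close> keeps the square root of \<open>f(z\<^sup>2)\<close> explicit as \<open>z / k(z\<^sup>2)\<close>, and
  makes all coefficients below polynomials in those of \<open>k\<close>.
\<close>
locale factored_univalent =
  fixes f k :: "complex \<Rightarrow> complex"
  assumes inj: "inj_on f (ball 0 1)"
    and k: "k holomorphic_on ball 0 1" "k 0 = 1"
    and fk: "\<And>z. z \<in> ball 0 1 \<Longrightarrow> f z * (k z)\<^sup>2 = z"
begin

lemma k_nonzero: "z \<in> ball 0 1 \<Longrightarrow> k z \<noteq> 0"
  using fk[of z] k(2) by (cases "z = 0") auto

definition K where "K = fps_expansion k 0"

lemma k_expansion: "k has_fps_expansion K"
  unfolding K_def using has_fps_expansion_fps_expansion[OF open_ball _ k(1)] by simp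

lemma K0: "fps_nth K 0 = 1"
  using has_fps_expansion_imp_0_eq_fps_nth_0[OF k_expansion] k(2) by simp

definition h where "h z = z / k (z\<^sup>2)"

lemma square_in_ball: "z \<in> ball 0 1 \<Longrightarrow> z\<^sup>2 \<in> ball (0::complex) 1"
  by (simp add: norm_power power_less_one_iff abs_square_less_1)

lemma ksq_holomorphic: "(\<lambda>z. k (z\<^sup>2)) holomorphic_on ball 0 1"
  by (rule holomorphic_on_compose_gen[OF _ k(1), unfolded o_def])
     (use square_in_ball in \<open>auto intro!: holomorphic_intros\<close>)

lemma h_univalent: "h holomorphic_on ball 0 1" "inj_on h (ball 0 1)" "h 0 = 0"
proof -
  show "h holomorphic_on ball 0 1" unfolding h_def
    by (intro holomorphic_intros ksq_holomorphic k_nonzero square_in_ball)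
  show "h 0 = 0" by (simp add: h_def)
  show "inj_on h (ball 0 1)"
  proof (rule inj_onI)
    fix z w :: complex assume zw: "z \<in> ball 0 1" "w \<in> ball 0 1" "h z = h w"
    have fh: "f (z\<^sup>2) = (h z)\<^sup>2" if "z \<in> ball 0 1" for z
      using fk[OF square_in_ball[OF that]] k_nonzero[OF square_in_ball[OF that]]
      by (simp add: h_def power_divide field_simps)
    have "f (z\<^sup>2) = f (w\<^sup>2)" using fh zw by metis
    then have "z\<^sup>2 = w\<^sup>2" using inj square_in_ball zw by (metis inj_onD)
    then show "z = w" using zw(3) k_nonzero[OF square_in_ball[OF zw(1)]] by (simp add: h_def)
  qed
qed

text \<open>
  For odd \<open>h\<close> and polynomials \<open>p\<close> of the parity of \<open>N\<close>, only even powers of \<open>z\<close> survive in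
  \<open>z\<^sup>N p(1/h(z))\<close>.
\<close>
lemma even_area_inequality:
  assumes "\<And>z. z \<in> ball 0 1 - {0} \<Longrightarrow> m (z\<^sup>2) = z ^ N * poly p (1 / h z)"
    and m: "m holomorphic_on ball 0 1" "m has_fps_expansion M" and "N \<le> 2 * J"
  shows "(\<Sum>j\<le>J. (2 * real j - real N) * (norm (fps_nth M j))\<^sup>2) \<le> 0"
proof -
  define MM where "MM = fps_compose M (fps_X ^ 2)"
  have nth: "fps_nth MM j = (if even j then fps_nth M (j div 2) else 0)" for j
    by (simp add: MM_def fps_nth_compose_X_power)
  have "(\<lambda>z. m (z\<^sup>2)) has_fps_expansion MM"
    using has_fps_expansion_compose[OF m(2), of "\<lambda>z. z\<^sup>2" "fps_X ^ 2"]
    unfolding MM_def o_def by (auto intro!: fps_expansion_intros)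
  moreover have "(\<lambda>z. m (z\<^sup>2)) holomorphic_on ball 0 1"
    by (rule holomorphic_on_compose_gen[OF _ m(1), unfolded o_def])
       (use square_in_ball in \<open>auto intro!: holomorphic_intros\<close>)
  ultimately have "(\<Sum>j\<le>2 * J. (real j - real N) * (norm (fps_nth MM j))\<^sup>2) \<le> 0"
    using area_theorem_poly[OF h_univalent, of "\<lambda>z. m (z\<^sup>2)" MM N p "2 * J"] assms by blast
  also have "(\<Sum>j\<le>2 * J. (real j - real N) * (norm (fps_nth MM j))\<^sup>2)
      = (\<Sum>j\<in>(\<lambda>i. 2 * i) ` {..J}. (real j - real N) * (norm (fps_nth MM j))\<^sup>2)"
    by (rule sum.mono_neutral_right) (auto simp: nth elim!: evenE)
  also have "\<dots> = (\<Sum>j\<le>J. (2 * real j - real N) * (norm (fps_nth M j))\<^sup>2)"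
    by (subst sum.reindex) (auto simp: inj_on_def nth)
  finally show ?thesis .
qed

abbreviation "k1 \<equiv> fps_nth K 1"
abbreviation "k2 \<equiv> fps_nth K 2"
abbreviation "k3 \<equiv> fps_nth K 3"

text \<open>
  The polynomial \<open>p(u) = u\<close> gives \<open>m(z\<^sup>2) = z / h(z) = k(z\<^sup>2)\<close>.
\<close>
lemma Grunsky_first_row: "(norm k1)\<^sup>2 + 3 * (norm k2)\<^sup>2 \<le> 1"
proof -
  have "(\<Sum>j\<le>2. (2 * real j - real 1) * (norm (fps_nth K j))\<^sup>2) \<le> 0"
    by (rule even_area_inequality[of k 1 "[:0, 1:]"])
       (use k k_expansion in \<open>auto simp: h_def\<close>)
  then show ?thesis by (simp add: K0 numeral_2_eq_2)
qed

text \<open>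
  The area inequality for \<open>p(u) = u\<^sup>3 + c u\<close> bounds the coefficients of \<open>z\<close> and \<open>z\<^sup>3\<close> in \<open>p(1/h)\<close> by
  those of \<open>z\<^sup>-\<^sup>1\<close> and \<open>z\<^sup>-\<^sup>3\<close>.  Pairing the former with the latter by the Cauchy-Schwarz
  inequality gives the quadratic form.
\<close>
lemma Grunsky_quadratic_form:
  "norm ((k3 + k1 * k2 + k1^3 / 3) + 2 * x * k2 + x\<^sup>2 * k1) \<le> 1/3 + (norm x)\<^sup>2"
proof -
  \<comment> \<open>This choice makes \<open>3 x\<close> the coefficient of \<open>1/z\<close> in \<open>p(1/h)\<close>.\<close>
  define c where "c = 3 * x - 3 * k1"
  define M where "M = K ^ 3 + fps_const c * (fps_X * K)"
  have "(\<Sum>j\<le>3. (2 * real j - real 3) * (norm (fps_nth M j))\<^sup>2) \<le> 0"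
  proof (rule even_area_inequality[of "\<lambda>z. k z ^ 3 + c * (z * k z)" 3 "[:0, c, 0, 1:]"])
    show "(\<lambda>z. k z ^ 3 + c * (z * k z)) holomorphic_on ball 0 1"
      by (intro holomorphic_intros k)
    show "(\<lambda>z. k z ^ 3 + c * (z * k z)) has_fps_expansion M"
      unfolding M_def by (intro fps_expansion_intros k_expansion)
    show "k (z\<^sup>2) ^ 3 + c * (z\<^sup>2 * k (z\<^sup>2)) = z ^ 3 * poly [:0, c, 0, 1:] (1 / h z)" if "z \<in> ball 0 1 - {0}" for z
      using that by (simp add: h_def power2_eq_square power3_eq_cube field_simps)
  qed auto
  moreover have "fps_nth M 0 = 1" "fps_nth M 1 = 3 * x"
    "fps_nth M 2 = 3 * k2 + 3 * x * k1" 
    "fps_nth M 3 = 3 * k3 + 3 * k1 * k2 + k1^3 + 3 * x * k2"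
    by (simp_all add: M_def c_def K0 power3_eq_cube fps_mult_nth eval_nat_numeral algebra_simps)
  ultimately have area: "(norm (3 * k2 + 3 * x * k1))\<^sup>2 + 3 * (norm (3 * k3 + 3 * k1 * k2 + k1^3 + 3 * x * k2))\<^sup>2
       \<le> 3 + (norm (3 * x))\<^sup>2"
    by (simp add: eval_nat_numeral)
  define A where "A = norm (3 * k2 + 3 * x * k1)"
  define B where "B = norm (3 * k3 + 3 * k1 * k2 + k1^3 + 3 * x * k2)"
  define S where "S = 3 + (norm (3 * x))\<^sup>2"
  have tri: "norm (u * v + 3 * w) \<le> norm u * norm v + 3 * norm w" for u v w :: complex
    using norm_triangle_ineq[of "u * v" "3 * w"] by (simp add: norm_mult)
  have "norm (9 * ((k3 + k1 * k2 + k1^3 / 3) + 2 * x * k2 + x\<^sup>2 * k1))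
     = norm (3 * x * (3 * k2 + 3 * x * k1) + 3 * (3 * k3 + 3 * k1 * k2 + k1^3 + 3 * x * k2))"
    by (simp add: algebra_simps power2_eq_square)
  also have "\<dots> \<le> norm (3 * x) * A + 3 * B"
    unfolding A_def B_def by (rule tri)
  also have "\<dots> \<le> S"
  proof -
    \<comment> \<open>The Cauchy-Schwarz inequality with weights 1 and 3.\<close>
    have "0 \<le> (norm (3 * x) - A)\<^sup>2 + 3 * (1 - B)\<^sup>2" by simp
    also have "\<dots> = S + (A\<^sup>2 + 3 * B\<^sup>2) - 2 * (norm (3 * x) * A + 3 * B)"
      by (simp add: S_def power2_eq_square algebra_simps)
    finally show ?thesis using area by (simp add: A_def B_def S_def)
  qed
  finally show ?thesis by (simp only: norm_mult) (simp add: S_def norm_mult power_mult_distrib)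
qed

end

section \<open>A sharp estimate on the Grunsky coefficients\<close>

text \<open>
  A symmetric matrix with rows \<open>(a, b)\<close> and \<open>(b, d)\<close> whose quadratic form is bounded by the squared
  norm is a contraction, and the corner \<open>d\<close> of a contraction lies in a disc determined by the other
  entries.  The disc is found by optimising \<open>x\<close>.
\<close>
lemma weak_Grunsky_imp_disc:
  fixes a b d :: complex
  assumes W: "\<And>x. norm (d + 2 * x * b + x\<^sup>2 * a) \<le> 1 + (norm x)\<^sup>2"
    and a: "norm a < 1"
  defines "m \<equiv> 1 - (norm a)\<^sup>2"
  shows "norm (d + cnj a * b\<^sup>2 / m) \<le> 1 - (norm b)\<^sup>2 / m"
proof -
  define w where "w = d + cnj a * b\<^sup>2 / m"
  \<comment> \<open>A unimodular factor that rotates \<open>w\<close> onto the nonnegative real axis.\<close>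
  define e where "e = (if w = 0 then 1 else norm w / w)"
  have ne: "norm e = 1" and ew: "e * w = norm w"
    by (auto simp: e_def norm_divide)
  have ee: "e * cnj e = 1"
    by (metis ne complex_norm_square of_real_1 power_one)
  have m: "m > 0" unfolding m_def using a by (simp add: power_less_one_iff abs_square_less_1)
  have aa: "a * cnj a = 1 - m"
    unfolding m_def by (simp flip: complex_norm_square)
  \<comment> \<open>The point at which \<open>Re (e (2 x b + x\<^sup>2 a)) - |x|\<^sup>2\<close> is maximal.\<close>
  define x where "x = (cnj (e * b) + cnj a * b) / m"
  define s where "s = b * (e * x)"
  have eqx: "e * (b + a * x) = cnj x"
  proof -
    have "m * (e * (b + a * x)) = e * (m * b + a * (cnj e * cnj b + cnj a * b))"
      using m by (simp add: x_def field_simps)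
    also have "\<dots> = e * b * (m + a * cnj a) + (e * cnj e) * a * cnj b"
      by (simp add: algebra_simps)
    also have "\<dots> = e * b + a * cnj b"
      by (simp add: aa ee)
    also have "\<dots> = m * cnj x"
      using m by (simp add: x_def)
    finally show ?thesis using m by simp
  qed
  have s: "s = (b * cnj b + e * cnj a * b\<^sup>2) / m"
    using ee by (simp add: s_def x_def field_simps power2_eq_square)
  have "e * (d + 2 * x * b + x\<^sup>2 * a) = e * d + s + x * (e * (b + a * x))"
    by (simp add: s_def algebra_simps power2_eq_square)
  also have "\<dots> = e * d + s + (norm x)\<^sup>2"
    by (simp add: eqx flip: complex_norm_square)
  also have "e * d = norm w - e * cnj a * b\<^sup>2 / m"
    using ew by (simp add: w_def algebra_simps)
  also have "\<dots> + s = norm w + (norm b)\<^sup>2 / m"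
    using m by (simp add: s field_simps flip: complex_norm_square)
  finally have "e * (d + 2 * x * b + x\<^sup>2 * a) = of_real (norm w + (norm b)\<^sup>2 / m + (norm x)\<^sup>2)"
    by simp
  then have "norm (d + 2 * x * b + x\<^sup>2 * a) = \<bar>norm w + (norm b)\<^sup>2 / m + (norm x)\<^sup>2\<bar>"
    by (metis mult_1 ne norm_mult norm_of_real)
  with W[of x] show ?thesis by (simp add: w_def)
qed

text \<open>
  The left-hand side is the square of \<open>|(3/2) x\<^sup>3 + 3 x z - (x/m) z\<^sup>2|\<close> for complex \<open>z\<close> with \<open>Re z = p\<close> and
  \<open>|z|\<^sup>2 = s\<close>.  It is a concave quadratic polynomial in \<open>p\<close>; after maximising over \<open>p\<close>,
  the difference of the two sides is a positive polynomial in \<open>u = x\<^sup>2\<close> and \<open>T\<close>, times \<open>m\<close>.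
\<close>
lemma cubic_part_bound_real:
  fixes x p s T m :: real
  assumes x: "0 < x" "x < 1" and m: "m = 1 - x\<^sup>2" and s: "s = m * T / 3" and T: "0 \<le> T" "T \<le> 1"
  shows "(3/2 * x^3)\<^sup>2 + 9 * x\<^sup>2 * s + (x / m)\<^sup>2 * s\<^sup>2 + 9 * x^4 * p
      - 3 * x^4 / m * (2 * p\<^sup>2 - s) - 6 * x\<^sup>2 / m * s * p \<le> (3/2 + T/3)\<^sup>2"
proof -
  define u where "u = x\<^sup>2"
  have u: "0 < u" "u < 1" using x by (auto simp: u_def power_less_one_iff abs_square_less_1)
  have mu: "m = 1 - u" "m > 0" using m u by (auto simp: u_def)
  have sm: "s / m = T / 3" using s mu by simp
  \<comment> \<open>Completing the square in \<open>p\<close>.\<close>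
  have "0 \<le> 6 * u\<^sup>2 / m * (p - m * (3/2 * u - T/3) / (2 * u))\<^sup>2"
    using mu by simp
  also have "\<dots> = 6 * u\<^sup>2 / m * p\<^sup>2 - 6 * u * p * (3/2 * u - T/3) + 3/2 * m * (3/2 * u - T/3)\<^sup>2"
    using mu(2) u by (simp add: field_simps power2_eq_square)
  finally have 1: "6 * u * p * (3/2 * u - T/3) - 6 * u\<^sup>2 / m * p\<^sup>2 \<le> 3/2 * m * (3/2 * u - T/3)\<^sup>2"
    by simp
  have "(3/2 * x^3)\<^sup>2 + 9 * x\<^sup>2 * s + (x / m)\<^sup>2 * s\<^sup>2 + 9 * x^4 * p
      - 3 * x^4 / m * (2 * p\<^sup>2 - s) - 6 * x\<^sup>2 / m * s * p
    = 9/4 * u^3 + 9 * u * s + u * (s / m)\<^sup>2 + 9 * u\<^sup>2 * p - 6 * u\<^sup>2 / m * p\<^sup>2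
       + 3 * u\<^sup>2 * (s / m) - 6 * u * (s / m) * p"
    by (simp add: u_def power_mult_distrib power_divide algebra_simps diff_divide_distrib flip: power_mult)
  also have "\<dots> = u * (3/2 * u + T/3)\<^sup>2 + 3 * u * m * T + 6 * u * p * (3/2 * u - T/3) - 6 * u\<^sup>2 / m * p\<^sup>2"
    unfolding sm by (simp add: s power2_eq_square power3_eq_cube algebra_simps)
  also have "\<dots> \<le> u * (3/2 * u + T/3)\<^sup>2 + 3 * u * m * T + 3/2 * m * (3/2 * u - T/3)\<^sup>2"
    using 1 by simp
  also have "\<dots> = (3/2 + T/3)\<^sup>2 - m * (9/4 + 9/4 * u * (1 - u) + 9/8 * u\<^sup>2 + T * (1 - u/2) - T\<^sup>2 / 18)"
    unfolding mu(1) by (simp add: power2_eq_square power3_eq_cube field_simps)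
  also have "\<dots> \<le> (3/2 + T/3)\<^sup>2"
  proof -
    have "T\<^sup>2 \<le> 1" using T by (simp add: power_le_one)
    moreover have "0 \<le> 9/4 * u * (1 - u)" "0 \<le> 9/8 * u\<^sup>2" "0 \<le> T * (1 - u/2)"
      using u T by auto
    ultimately have "0 \<le> 9/4 + 9/4 * u * (1 - u) + 9/8 * u\<^sup>2 + T * (1 - u/2) - T\<^sup>2 / 18"
      by linarith
    then show ?thesis using mu(2) by simp
  qed
  finally show ?thesis .
qed

text \<open>
  A rotation makes \<open>a\<close> real and positive, because all three terms are homogeneous of degree 3 when
  \<open>a\<close> and \<open>b\<close> are given the degrees 1 and 2 and conjugates count negatively.
\<close>
lemma cubic_part_bound:
  fixes a b :: complex and T m :: real
  assumes a: "norm a < 1" and m: "m = 1 - (norm a)\<^sup>2" and T: "T = 3 * (norm b)\<^sup>2 / m" "T \<le> 1"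
  shows "norm (3/2 * a^3 + 3 * a * b - cnj a * b\<^sup>2 / m) \<le> 3/2 + T/3"
proof (cases "a = 0")
  case True
  then show ?thesis using T m by simp
next
  case False
  define x where "x = norm a"
  have x: "0 < x" "x < 1" using a False by (auto simp: x_def)
  define e where "e = a / x"
  have e: "a = x * e" "norm e = 1" using x by (auto simp: e_def x_def norm_divide)
  have ee: "cnj e * e = 1"
    by (metis e(2) complex_norm_square of_real_1 power_one mult.commute)
  define z where "z = b * (cnj e)\<^sup>2"
  have b: "b = z * e\<^sup>2"
    using ee by (simp add: z_def power2_eq_square) (metis mult.assoc mult.commute mult_1)
  define p where "p = Re z"
  define s where "s = (norm b)\<^sup>2"
  have mp: "m > 0" using x m by (simp add: x_def power_less_one_iff abs_square_less_1)
  have s: "s = (Re z)\<^sup>2 + (Im z)\<^sup>2"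
    using e(2) by (simp add: s_def b norm_mult norm_power cmod_power2)
  have "3/2 * a^3 + 3 * a * b - cnj a * b\<^sup>2 / m = e^3 * (3/2 * x^3 + 3 * x * z - x / m * z\<^sup>2 * (cnj e * e))"
    by (simp add: e(1) b power2_eq_square power3_eq_cube algebra_simps)
  then have eq: "norm (3/2 * a^3 + 3 * a * b - cnj a * b\<^sup>2 / m) = norm (3/2 * x^3 + 3 * x * z - x / m * z\<^sup>2)"
    by (simp add: ee e norm_mult norm_power)
  have "(norm (3/2 * x^3 + 3 * x * z - x / m * z\<^sup>2))\<^sup>2 = (3/2 * x^3)\<^sup>2 + 9 * x\<^sup>2 * s + (x / m)\<^sup>2 * s\<^sup>2 + 9 * x^4 * p
      - 3 * x^4 / m * (2 * p\<^sup>2 - s) - 6 * x\<^sup>2 / m * s * p"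
  proof -
    define k where "k = x / m"
    have "(norm (3/2 * x^3 + 3 * x * z - k * z\<^sup>2))\<^sup>2 = (3/2 * x^3)\<^sup>2 + 9 * x\<^sup>2 * s + k\<^sup>2 * s\<^sup>2 + 9 * x^4 * p
      - 3 * x^3 * k * (2 * p\<^sup>2 - s) - 6 * x * k * s * p"
      unfolding cmod_power2 s p_def
      by (simp add: power2_eq_square power3_eq_cube power4_eq_xxxx algebra_simps)
    then show ?thesis
      by (simp add: k_def power2_eq_square power3_eq_cube power4_eq_xxxx)
  qed
  also have "\<dots> \<le> (3/2 + T/3)\<^sup>2"
    using x T mp m by (intro cubic_part_bound_real) (auto simp: x_def s_def)
  finally show ?thesis
    unfolding eq by (rule power2_le_imp_le) (use T mp in auto)
qed

text \<open>
  Here \<open>a\<close>, \<open>b\<close>, \<open>d\<close> stand for \<open>k\<^sub>1\<close>, \<open>k\<^sub>2\<close>, \<open>\<kappa>\<close>.  With \<open>T = 3 |b|\<^sup>2 / m\<close>, the distance of \<open>d\<close>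
  from the centre of its disc is at most \<open>(1 - T)/3\<close>, and what remains of \<open>d + 3 a b + (3/2) a\<^sup>3\<close> is
  at most \<open>3/2 + T/3\<close>.  The two bounds add up to \<open>11/6\<close>.
\<close>
lemma Grunsky_functional_bound:
  fixes a b d :: complex
  assumes W: "\<And>x. norm (d + 2 * x * b + x\<^sup>2 * a) \<le> 1/3 + (norm x)\<^sup>2"
    and R: "(norm a)\<^sup>2 + 3 * (norm b)\<^sup>2 \<le> 1"
  shows "norm (d + 4 * a * b + 3 * a^3) - norm (b + 3/2 * a\<^sup>2) \<le> 11/6"
proof -
  have a1: "norm a \<le> 1" 
    using R by (smt (verit) power2_less_0 one_le_power power2_le_imp_le one_power2 zero_le_power2)
  have "norm (d + 3 * a * b + 3/2 * a^3) \<le> 11/6"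
  proof (cases "norm a = 1")
    case True
    then have "b = 0" using R by simp
    then show ?thesis
      using W[of 0] norm_triangle_ineq[of d "3/2 * a^3"] True by (simp add: norm_mult norm_power)
  next
    case False
    then have a: "norm a < 1" using a1 by simp
    define m where "m = 1 - (norm a)\<^sup>2"
    have m: "m > 0" unfolding m_def using a by (simp add: power_less_one_iff abs_square_less_1)
    define T where "T = 3 * (norm b)\<^sup>2 / m"
    have T: "T \<le> 1" using R m by (simp add: T_def m_def)
    \<comment> \<open>The substitution \<open>x = sqrt 3 y\<close> turns the weights 1 and 1/3 of the hypothesis into 1 and 1.\<close>
    have "norm (3 * d + cnj a * (sqrt 3 * b)\<^sup>2 / m) \<le> 1 - (norm (sqrt 3 * b))\<^sup>2 / m"
      unfolding m_def
    proof (rule weak_Grunsky_imp_disc[OF _ a])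
      fix x :: complex
      define y where "y = x / sqrt 3"
      have x: "x = sqrt 3 * y" by (simp add: y_def)
      have 3: "complex_of_real (sqrt 3) * complex_of_real (sqrt 3) = 3"
        by (simp flip: of_real_mult)
      have "3 * d + 2 * x * (sqrt 3 * b) + x\<^sup>2 * a 
          = 3 * d + (of_real (sqrt 3) * of_real (sqrt 3)) * (2 * y * b + y\<^sup>2 * a)"
        by (simp add: x algebra_simps power2_eq_square)
      then have "norm (3 * d + 2 * x * (sqrt 3 * b) + x\<^sup>2 * a) = norm (3 * (d + 2 * y * b + y\<^sup>2 * a))"
        unfolding 3 by (simp add: algebra_simps)
      also have "\<dots> = 3 * norm (d + 2 * y * b + y\<^sup>2 * a)"
        by (simp only: norm_mult) simp
      also have "\<dots> \<le> 3 * (1/3 + (norm y)\<^sup>2)"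
        using W[of y] by simp
      also have "\<dots> = 1 + (norm x)\<^sup>2" by (simp add: x norm_mult power_mult_distrib)
      finally show "norm (3 * d + 2 * x * (sqrt 3 * b) + x\<^sup>2 * a) \<le> 1 + (norm x)\<^sup>2" .
    qed
    also have "3 * d + cnj a * (sqrt 3 * b)\<^sup>2 / m = 3 * (d + cnj a * b\<^sup>2 / m)"
      by (simp add: power_mult_distrib flip: of_real_power)
    also have "norm \<dots> = 3 * norm (d + cnj a * b\<^sup>2 / m)"
      by (simp only: norm_mult) simp
    finally have 1: "norm (d + cnj a * b\<^sup>2 / m) \<le> (1 - T) / 3"
      by (simp add: norm_mult power_mult_distrib T_def)
    have "norm (3/2 * a^3 + 3 * a * b - cnj a * b\<^sup>2 / m) \<le> 3/2 + T/3"
      by (rule cubic_part_bound[OF a m_def T_def T])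
    with 1 norm_triangle_ineq[of "d + cnj a * b\<^sup>2 / m" "3/2 * a^3 + 3 * a * b - cnj a * b\<^sup>2 / m"]
    show ?thesis by (simp add: algebra_simps)
  qed
  moreover have "norm (d + 4 * a * b + 3 * a^3) \<le> norm (d + 3 * a * b + 3/2 * a^3) + norm (a * (b + 3/2 * a\<^sup>2))"
    using norm_triangle_ineq[of "d + 3 * a * b + 3/2 * a^3" "a * (b + 3/2 * a\<^sup>2)"]
    by (simp add: algebra_simps power2_eq_square power3_eq_cube)
  moreover have "norm (a * (b + 3/2 * a\<^sup>2)) \<le> norm (b + 3/2 * a\<^sup>2)"
    using a1 by (simp add: norm_mult mult_left_le_one_le)
  ultimately show ?thesis by linarith
qed

section \<open>Logarithmic coefficients of the inverse\<close>

lemma fps_mult_nth_le_3: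
  fixes A B :: "'a :: comm_ring_1 fps"
  shows "fps_nth (A * B) 0 = fps_nth A 0 * fps_nth B 0"
    "fps_nth (A * B) 1 = fps_nth A 0 * fps_nth B 1 + fps_nth A 1 * fps_nth B 0"
    "fps_nth (A * B) 2 = fps_nth A 0 * fps_nth B 2 + fps_nth A 1 * fps_nth B 1 + fps_nth A 2 * fps_nth B 0"
    "fps_nth (A * B) 3 = fps_nth A 0 * fps_nth B 3 + fps_nth A 1 * fps_nth B 2 + fps_nth A 2 * fps_nth B 1 + fps_nth A 3 * fps_nth B 0"
  by (simp_all add: fps_mult_nth eval_nat_numeral algebra_simps)

lemma fps_compose_nth_le_3:
  fixes A B :: "'a :: comm_ring_1 fps"
  assumes B0: "fps_nth B 0 = 0"
  shows "fps_nth (fps_compose A B) 1 = fps_nth A 1 * fps_nth B 1"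
    "fps_nth (fps_compose A B) 2 = fps_nth A 1 * fps_nth B 2 + fps_nth A 2 * (fps_nth B 1)\<^sup>2"
    "fps_nth (fps_compose A B) 3 = fps_nth A 1 * fps_nth B 3 + fps_nth A 2 * (2 * fps_nth B 1 * fps_nth B 2)
       + fps_nth A 3 * (fps_nth B 1)^3"
proof -
  have sq: "fps_nth (B\<^sup>2) 1 = 0" "fps_nth (B\<^sup>2) 2 = (fps_nth B 1)\<^sup>2"
     "fps_nth (B\<^sup>2) 3 = 2 * fps_nth B 1 * fps_nth B 2"
    by (simp_all add: power2_eq_square fps_mult_nth_le_3 B0 algebra_simps)
  have cb: "fps_nth (B^3) 3 = (fps_nth B 1)^3"
    by (simp add: power3_eq_cube fps_mult_nth_le_3 B0 mult_ac)
  have sets: "{0..1::nat} = {0, 1}" "{0..2::nat} = {0, 1, 2}" "{0..3::nat} = {0, 1, 2, 3}" by auto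
  show "fps_nth (fps_compose A B) 1 = fps_nth A 1 * fps_nth B 1"
    "fps_nth (fps_compose A B) 2 = fps_nth A 1 * fps_nth B 2 + fps_nth A 2 * (fps_nth B 1)\<^sup>2"
    "fps_nth (fps_compose A B) 3 = fps_nth A 1 * fps_nth B 3 + fps_nth A 2 * (2 * fps_nth B 1 * fps_nth B 2)
       + fps_nth A 3 * (fps_nth B 1)^3"
    unfolding fps_compose_nth sets by (simp_all add: sq cb algebra_simps)
qed

text \<open>
  Let \<open>l(w) = log (f\<^sup>-\<^sup>1(w) / w)\<close>.  Then \<open>exp (l \<circ> f) = k\<^sup>2\<close>, so \<open>E = l \<circ> f\<close> satisfies
  \<open>k E' = 2 k'\<close>.  Together with \<open>f k\<^sup>2 = z\<close>, this determines the coefficients of \<open>l\<close> recursively.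
\<close>
lemma inverse_log_coeff_eq:
  assumes f: "f \<in> normalized_univalent"
    and k: "k holomorphic_on ball 0 1" "k 0 = 1" and fk: "\<And>z. z \<in> ball 0 1 \<Longrightarrow> f z * (k z)\<^sup>2 = z"
    and K: "k has_fps_expansion K"
  shows "inverse_log_coeff f 2 = fps_nth K 2 + 3/2 * (fps_nth K 1)\<^sup>2"
    and "inverse_log_coeff f 3 = fps_nth K 3 + 5 * fps_nth K 1 * fps_nth K 2 + 10/3 * (fps_nth K 1)^3"
proof -
  define g where "g = disk_inverse f"
  define l where "l = log_quotient g"
  define Lam where "Lam = fps_expansion l 0"
  note props = disk_inverse_properties[OF f]
  have hol: "f holomorphic_on ball 0 1" and inj: "inj_on f (ball 0 1)"
    and f0: "f 0 = 0" and f1: "deriv f 0 = 1"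
    using f analytic_imp_holomorphic by (auto simp: normalized_univalent_def normalized_analytic_def)
  obtain r where r: "r > 0" "\<And>w. w \<in> ball 0 r \<Longrightarrow> (\<lambda>n. fps_nth Lam n * w ^ n) sums l w"
    using log_quotient_sums[OF props] unfolding Lam_def l_def g_def by blast
  have lLam: "l has_fps_expansion Lam"
    unfolding has_fps_expansion_def
  proof
    have "ereal (norm (complex_of_real (r / 2))) \<le> fps_conv_radius Lam"
      unfolding fps_conv_radius_def
      by (rule conv_radius_geI, rule sums_summable, rule r(2)) (use r(1) in simp)
    moreover have "0 < ereal (norm (complex_of_real (r / 2)))" using r(1) by simp
    ultimately show "0 < fps_conv_radius Lam" by (rule less_le_trans[rotated])
    show "\<forall>\<^sub>F z in nhds 0. eval_fps Lam z = l z"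
      by (rule eventually_mono[OF eventually_nhds_in_open[OF open_ball, of 0 0 r]])
         (use r(1) in \<open>auto simp: eval_fps_def sums_unique[OF r(2), symmetric]\<close>)
  qed
  define F where "F = fps_expansion f 0"
  have fF: "f has_fps_expansion F"
    unfolding F_def using has_fps_expansion_fps_expansion[OF open_ball _ hol] by simp
  have F0: "fps_nth F 0 = 0" and K0: "fps_nth K 0 = 1" and Lam0: "fps_nth Lam 0 = 0"
    using has_fps_expansion_imp_0_eq_fps_nth_0[OF fF] has_fps_expansion_imp_0_eq_fps_nth_0[OF K]
      has_fps_expansion_imp_0_eq_fps_nth_0[OF lLam] f0 k(2) by (auto simp: l_def log_quotient_def)
  have FK: "F * K\<^sup>2 = fps_X"
  proof (rule fps_expansion_unique_complex)
    show "(\<lambda>z. f z * (k z)\<^sup>2) has_fps_expansion F * K\<^sup>2"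
      by (intro fps_expansion_intros fF K)
    have "eventually (\<lambda>z. z = f z * (k z)\<^sup>2) (nhds 0)"
      using eventually_nhds_in_open[OF open_ball, of 0 0 1] by (auto elim!: eventually_mono simp: fk)
    then show "(\<lambda>z. f z * (k z)\<^sup>2) has_fps_expansion fps_X"
      by (rule has_fps_expansion_cong[THEN iffD1, OF _ refl has_fps_expansion_fps_X])
  qed
  define E where "E = fps_compose Lam F"
  have lf: "(l \<circ> f) has_fps_expansion E"
    unfolding E_def by (rule has_fps_expansion_compose[OF lLam fF F0])
  have "fps_compose (fps_exp 1) E = K\<^sup>2"
  proof (rule fps_expansion_unique_complex)
    show "(exp \<circ> (l \<circ> f)) has_fps_expansion fps_compose (fps_exp 1) E"
    proof (rule has_fps_expansion_compose[OF _ lf])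
      show "exp has_fps_expansion fps_exp (1::complex)"
        using has_fps_expansion_exp[of "1::complex"] by simp
      show "fps_nth E 0 = 0" by (simp add: E_def Lam0)
    qed
    have "eventually (\<lambda>z. (k z)\<^sup>2 = (exp \<circ> (l \<circ> f)) z) (nhds 0)"
      using eventually_nhds_in_open[OF open_ball, of 0 0 1]
    proof (rule eventually_mono)
      fix z :: complex assume z: "z \<in> ball 0 1"
      have gz: "g (f z) = z" using the_inv_into_f_f[OF inj z] by (simp add: g_def disk_inverse_def)
      show "(k z)\<^sup>2 = (exp \<circ> (l \<circ> f)) z"
      proof (cases "z = 0")
        case True
        then show ?thesis by (simp add: k f0 l_def log_quotient_def)
      next
        case False
        then have "f z \<noteq> 0" using fk[OF z] by auto
        then have "exp (l (f z)) = z / f z" using False by (simp add: l_def log_quotient_def gz)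
        also have "\<dots> = (k z)\<^sup>2" using fk[OF z] \<open>f z \<noteq> 0\<close> by (simp add: field_simps)
        finally show ?thesis by simp
      qed
    qed simp
    then show "(exp \<circ> (l \<circ> f)) has_fps_expansion K\<^sup>2"
      by (rule has_fps_expansion_cong[THEN iffD1, OF _ refl]) (intro fps_expansion_intros K)
  qed
  then have "fps_deriv (fps_compose (fps_exp 1) E) = fps_deriv (K\<^sup>2)" by simp
  moreover have "fps_deriv (fps_compose (fps_exp 1) E) = K\<^sup>2 * fps_deriv E"
    using \<open>fps_compose (fps_exp 1) E = K\<^sup>2\<close> by (subst fps_compose_deriv) (auto simp: E_def Lam0)
  moreover have "fps_deriv (K\<^sup>2) = K * (2 * fps_deriv K)"
    by (simp add: fps_deriv_power power2_eq_square algebra_simps)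
  ultimately have "K * (K * fps_deriv E) = K * (2 * fps_deriv K)"
    by (simp add: power2_eq_square mult.assoc)
  moreover have "K \<noteq> 0" using K0 by auto
  ultimately have KE: "K * fps_deriv E = 2 * fps_deriv K" by simp
  define a b c where "a = fps_nth K 1" and "b = fps_nth K 2" and "c = fps_nth K 3"
  have F: "fps_nth F 1 = 1" "fps_nth F 2 = - 2 * a" "fps_nth F 3 = 3 * a\<^sup>2 - 2 * b"
  proof -
    have "fps_nth (F * K\<^sup>2) 1 = 1" "fps_nth (F * K\<^sup>2) 2 = 0" "fps_nth (F * K\<^sup>2) 3 = 0"
      by (simp_all add: FK)
    then have e: "fps_nth F 1 = 1" "fps_nth F 2 + fps_nth F 1 * (2 * a) = 0" 
      "fps_nth F 3 + fps_nth F 2 * (2 * a) + fps_nth F 1 * (2 * b + a\<^sup>2) = 0"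
      by (simp_all add: a_def b_def c_def power2_eq_square fps_mult_nth_le_3 F0 K0 algebra_simps)
    show "fps_nth F 1 = 1" by (rule e)
    show F2: "fps_nth F 2 = - 2 * a" using e(1,2) by (simp add: add_eq_0_iff2)
    show "fps_nth F 3 = 3 * a\<^sup>2 - 2 * b" using e(3) unfolding e(1) F2 
      by (simp add: power2_eq_square) algebra
  qed
  have "fps_nth (K * fps_deriv E) j = 2 * fps_nth (fps_deriv K) j" for j
    unfolding KE by (simp only: mult_2 fps_add_nth)
  moreover have d: "fps_nth (fps_deriv A) 0 = fps_nth A 1" "fps_nth (fps_deriv A) 1 = 2 * fps_nth A 2" 
    "fps_nth (fps_deriv A) 2 = 3 * fps_nth A 3" for A :: "complex fps"
    by (simp_all add: numeral_2_eq_2 numeral_3_eq_3)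
  ultimately have K2: "fps_nth (K * fps_deriv E) 0 = 2 * a" "fps_nth (K * fps_deriv E) 1 = 4 * b"
    "fps_nth (K * fps_deriv E) 2 = 6 * c"
    by (simp_all only: a_def b_def c_def) simp_all
  have E: "fps_nth E 1 = 2 * a" "2 * fps_nth E 2 + a * fps_nth E 1 = 4 * b" 
     "3 * fps_nth E 3 + 2 * a * fps_nth E 2 + b * fps_nth E 1 = 6 * c"
    using K2 unfolding fps_mult_nth_le_3 d K0 a_def[symmetric] b_def[symmetric] by (simp_all add: algebra_simps)
  have EL: "fps_nth E 1 = fps_nth Lam 1 * fps_nth F 1"
    "fps_nth E 2 = fps_nth Lam 1 * fps_nth F 2 + fps_nth Lam 2 * (fps_nth F 1)\<^sup>2"
    "fps_nth E 3 = fps_nth Lam 1 * fps_nth F 3 + fps_nth Lam 2 * (2 * fps_nth F 1 * fps_nth F 2) + fps_nth Lam 3 * (fps_nth F 1)^3"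
    unfolding E_def by (rule fps_compose_nth_le_3[OF F0])+
  have L1: "fps_nth Lam 1 = 2 * a" using E(1) EL(1) F(1) by simp
  have L2: "fps_nth Lam 2 = 2 * b + 3 * a\<^sup>2"
    using E(2) unfolding EL L1 F by (simp add: power2_eq_square) algebra
  have L3: "fps_nth Lam 3 = 2 * c + 10 * a * b + 20 / 3 * a^3"
    using E(3) unfolding EL L1 L2 F by (simp add: power2_eq_square power3_eq_cube field_simps)
  show "inverse_log_coeff f 2 = fps_nth K 2 + 3/2 * (fps_nth K 1)\<^sup>2"
    using L2 by (simp add: inverse_log_coeff_def Lam_def l_def g_def a_def b_def field_simps)
  show "inverse_log_coeff f 3 = fps_nth K 3 + 5 * fps_nth K 1 * fps_nth K 2 + 10/3 * (fps_nth K 1)^3"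
    using L3 by (simp add: inverse_log_coeff_def Lam_def l_def g_def a_def b_def c_def field_simps)
qed

section \<open>The Koebe function and the sharp bound\<close>

definition koebe :: "complex \<Rightarrow> complex" where "koebe z = z / (1 - z)\<^sup>2"

lemma koebe_univalent: "koebe \<in> normalized_univalent"
proof -
  have nz: "1 - z \<noteq> 0" if "z \<in> ball 0 1" for z :: complex using that by auto
  have "koebe holomorphic_on ball 0 1"
    unfolding koebe_def using nz by (intro holomorphic_intros) auto
  then have an: "koebe analytic_on ball 0 1" by (simp add: analytic_on_open)
  have "(koebe has_field_derivative 1) (at 0)"
    unfolding koebe_def by (auto intro!: derivative_eq_intros)
  then have d: "deriv koebe 0 = 1" by (rule DERIV_imp_deriv)
  have "inj_on koebe (ball 0 1)"
  proof (rule inj_onI)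
    fix z w :: complex assume z: "z \<in> ball 0 1" and w: "w \<in> ball 0 1" and eq: "koebe z = koebe w"
    have "z * (1 - w)\<^sup>2 = w * (1 - z)\<^sup>2"
      using eq nz[OF z] nz[OF w] by (simp add: koebe_def frac_eq_eq)
    then have "(z - w) * (1 - z * w) = 0" by (simp add: power2_eq_square algebra_simps)
    moreover have "norm (z * w) < 1"
      using z w mult_strict_mono[of "norm z" 1 "norm w" 1] by (cases "w = 0") (auto simp: norm_mult)
    then have "1 - z * w \<noteq> 0" by auto
    ultimately show "z = w" by simp
  qed
  then show ?thesis using an d by (simp add: normalized_univalent_def normalized_analytic_def koebe_def)
qed

theorem theorem3:
  shows "(\<forall>f \<in> normalized_univalent.
            norm (inverse_log_coeff f 3) - norm (inverse_log_coeff f 2) \<le> 11 / 6) \<and>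
         (\<exists>f \<in> normalized_univalent.
            norm (inverse_log_coeff f 3) - norm (inverse_log_coeff f 2) = 11 / 6)"
proof (intro conjI ballI)
  fix f assume f: "f \<in> normalized_univalent"
  then have hol: "f holomorphic_on ball 0 1" and inj: "inj_on f (ball 0 1)"
    and f0: "f 0 = 0" and f1: "deriv f 0 = 1"
    using analytic_imp_holomorphic by (auto simp: normalized_univalent_def normalized_analytic_def)
  obtain k where factor: "k holomorphic_on ball 0 1" "k 0 = 1" "\<And>z. z \<in> ball 0 1 \<Longrightarrow> f z * (k z)\<^sup>2 = z"
    using inverse_square_root_factor[OF hol inj f0 f1] by metis
  interpret factored_univalent f k by standard (use inj factor in auto)
  have "norm ((k3 + k1 * k2 + k1^3 / 3) + 4 * k1 * k2 + 3 * k1^3) - norm (k2 + 3/2 * k1\<^sup>2) \<le> 11/6"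
    by (rule Grunsky_functional_bound[OF Grunsky_quadratic_form Grunsky_first_row])
  moreover have "(k3 + k1 * k2 + k1^3 / 3) + 4 * k1 * k2 + 3 * k1^3 = inverse_log_coeff f 3"
    using inverse_log_coeff_eq(2)[OF f factor k_expansion] by (simp add: field_simps)
  moreover have "k2 + 3/2 * k1\<^sup>2 = inverse_log_coeff f 2"
    by (rule inverse_log_coeff_eq(1)[OF f factor k_expansion, symmetric])
  ultimately show "norm (inverse_log_coeff f 3) - norm (inverse_log_coeff f 2) \<le> 11 / 6"
    by simp
next
  define K :: "complex fps" where "K = 1 - fps_X"
  have K: "(\<lambda>z. 1 - z) has_fps_expansion K"
    unfolding K_def by (intro fps_expansion_intros)
  have fk: "koebe z * (1 - z)\<^sup>2 = z" if "z \<in> ball 0 1" for z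
    using that by (auto simp: koebe_def)
  have hol: "(\<lambda>z. 1 - z) holomorphic_on ball 0 (1::real)" by (intro holomorphic_intros)
  have "inverse_log_coeff koebe 2 = 3/2" "inverse_log_coeff koebe 3 = - (10/3)"
    using inverse_log_coeff_eq[OF koebe_univalent hol _ fk K] by (simp_all add: K_def)
  then have "norm (inverse_log_coeff koebe 3) - norm (inverse_log_coeff koebe 2) = 11 / 6"
    by (simp only: norm_minus_cancel norm_divide norm_numeral)
  then show "\<exists>f \<in> normalized_univalent.
            norm (inverse_log_coeff f 3) - norm (inverse_log_coeff f 2) = 11 / 6"
    using koebe_univalent by blast
qed

end
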